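(* Let $R$ be a ring, and suppose the category of left $R$-modules admits an additive closed symmetric monoidal structure with monoidal product $-\wedge-$. Then $R\wedge R$ is a $2$-fold $R$-bimodule, and there is an isomorphism, natural in the left $R$-modules $A$ and $B$, of bifunctors $$(R\wedge R)_{B,A}\otimes A\otimes B\;\cong\; A\wedge B .$$
   Context: Rings are associative and unital, not necessarily commutative; $\otimes$ means $\otimes_R$. A closed symmetric monoidal structure on the category of left $R$-modules is additive if the monoidal product is an additive functor in each variable. A $2$-fold $R$-bimodule $\Lambda$ is a left $R$-module with two right $R$-module structures $\lambda\odot_1 r$ and $\lambda\odot_2 r$ which commute with each other and with the left structure. The notation $\Lambda_{B,A}\otimes A\otimes B$ means that $\odot_1$ is used to tensor with $B$ and $\odot_2$ is used to tensor with $A$: it is the left $R$-module obtained from $\Lambda\otimes_{\mathbb Z}A\otimes_{\mathbb Z}B$ by imposing $(\lambda\odot_1 r)\otimes a\otimes b=\lambda\otimes a\otimes (rb)$ and $(\lambda\odot_2 r)\otimes a\otimes b=\lambda\otimes (ra)\otimes b$. The two right structures on $R\wedge R$ are those induced by functoriality from the left $R$-module maps $\rho_r\colon R\to R$, $\rho_r(s)=sr$: $x\odot_1 r=(1\wedge\rho_r)(x)$ and $x\odot_2 r=(\rho_r\wedge 1)(x)$. *)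

theory Defs
  imports
    "HOL-Algebra.Module"
    "HOL-Algebra.Generated_Groups"
    "HOL-Algebra.Free_Abelian_Groups"
    "HOL-Library.Equipollence"
    "HOL-Library.FuncSet"
begin

section \<open>Left modules over a not necessarily commutative ring\<close>

text \<open>The library locale \<open>module\<close> assumes that the ring is commutative; the following is
  the same list of axioms over an arbitrary (associative, unital) ring.\<close>

locale left_module = R?: ring R + M?: abelian_group M for R (structure) and M (structure) +
  assumes smult_closed:
      "\<lbrakk>a \<in> carrier R; x \<in> carrier M\<rbrakk> \<Longrightarrow> a \<odot>\<^bsub>M\<^esub> x \<in> carrier M"
    and smult_l_distr:
      "\<lbrakk>a \<in> carrier R; b \<in> carrier R; x \<in> carrier M\<rbrakk> \<Longrightarrow>
        (a \<oplus> b) \<odot>\<^bsub>M\<^esub> x = a \<odot>\<^bsub>M\<^esub> x \<oplus>\<^bsub>M\<^esub> b \<odot>\<^bsub>M\<^esub> x"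
    and smult_r_distr:
      "\<lbrakk>a \<in> carrier R; x \<in> carrier M; y \<in> carrier M\<rbrakk> \<Longrightarrow>
        a \<odot>\<^bsub>M\<^esub> (x \<oplus>\<^bsub>M\<^esub> y) = a \<odot>\<^bsub>M\<^esub> x \<oplus>\<^bsub>M\<^esub> a \<odot>\<^bsub>M\<^esub> y"
    and smult_assoc:
      "\<lbrakk>a \<in> carrier R; b \<in> carrier R; x \<in> carrier M\<rbrakk> \<Longrightarrow>
        (a \<otimes> b) \<odot>\<^bsub>M\<^esub> x = a \<odot>\<^bsub>M\<^esub> (b \<odot>\<^bsub>M\<^esub> x)"
    and smult_one:
      "x \<in> carrier M \<Longrightarrow> \<one> \<odot>\<^bsub>M\<^esub> x = x"

definition lmod_hom ::
    "('r, 'z) ring_scheme \<Rightarrow> ('r, 'a) module \<Rightarrow> ('r, 'b) module \<Rightarrow> ('a \<Rightarrow> 'b) set" where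
  "lmod_hom R M N = {f \<in> carrier M \<rightarrow> carrier N.
     (\<forall>x\<in>carrier M. \<forall>y\<in>carrier M. f (x \<oplus>\<^bsub>M\<^esub> y) = f x \<oplus>\<^bsub>N\<^esub> f y) \<and>
     (\<forall>r\<in>carrier R. \<forall>x\<in>carrier M. f (r \<odot>\<^bsub>M\<^esub> x) = r \<odot>\<^bsub>N\<^esub> f x)}"

definition lmod_iso ::
    "('r, 'z) ring_scheme \<Rightarrow> ('r, 'a) module \<Rightarrow> ('r, 'b) module \<Rightarrow> ('a \<Rightarrow> 'b) set" where
  "lmod_iso R M N = {f \<in> lmod_hom R M N. bij_betw f (carrier M) (carrier N)}"

definition regular_module :: "('r, 'z) ring_scheme \<Rightarrow> ('r, 'r) module" where
  "regular_module R = \<lparr>carrier = carrier R, mult = mult R, one = one R,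
     ring.zero = \<zero>\<^bsub>R\<^esub>, add = add R, smult = mult R\<rparr>"

lemma regular_module_left_module:
  fixes R (structure)
  assumes "ring R"
  shows "left_module R (regular_module R)"
proof -
  interpret ring R by fact
  have "abelian_group (regular_module R)"
    by (rule abelian_groupI)
      (auto simp: regular_module_def a_ac intro: l_neg bexI[of _ "\<ominus> _"])
  then show ?thesis
    by (intro left_module.intro left_module_axioms.intro assms)
      (auto simp: regular_module_def l_distr r_distr m_assoc)
qed


section \<open>Categories, functors and adjunctions\<close>

record ('o, 'a) category =
  Obj :: "'o set"
  Hom :: "'o \<Rightarrow> 'o \<Rightarrow> 'a set"
  Comp :: "'a \<Rightarrow> 'a \<Rightarrow> 'a"  (infixr \<open>\<cdot>\<index>\<close> 55)
  Id :: "'o \<Rightarrow> 'a"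

locale category =
  fixes C :: "('o, 'a) category" (structure)
  assumes Hom_disjoint: "\<lbrakk>f \<in> Hom C A B; f \<in> Hom C A' B'\<rbrakk> \<Longrightarrow> A = A' \<and> B = B'"
    and Comp_in_Hom:
      "\<lbrakk>A \<in> Obj C; B \<in> Obj C; D \<in> Obj C; f \<in> Hom C A B; g \<in> Hom C B D\<rbrakk> \<Longrightarrow> g \<cdot> f \<in> Hom C A D"
    and Id_in_Hom: "A \<in> Obj C \<Longrightarrow> Id C A \<in> Hom C A A"
    and Comp_assoc:
      "\<lbrakk>A \<in> Obj C; B \<in> Obj C; D \<in> Obj C; E \<in> Obj C;
        f \<in> Hom C A B; g \<in> Hom C B D; h \<in> Hom C D E\<rbrakk> \<Longrightarrow> (h \<cdot> g) \<cdot> f = h \<cdot> (g \<cdot> f)"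
    and Comp_Id_left: "\<lbrakk>A \<in> Obj C; B \<in> Obj C; f \<in> Hom C A B\<rbrakk> \<Longrightarrow> Id C B \<cdot> f = f"
    and Comp_Id_right: "\<lbrakk>A \<in> Obj C; B \<in> Obj C; f \<in> Hom C A B\<rbrakk> \<Longrightarrow> f \<cdot> Id C A = f"

definition isomorphisms :: "('o, 'a) category \<Rightarrow> 'o \<Rightarrow> 'o \<Rightarrow> 'a set" where
  "isomorphisms C A B = {f \<in> Hom C A B. \<exists>g\<in>Hom C B A. g \<cdot>\<^bsub>C\<^esub> f = Id C A \<and> f \<cdot>\<^bsub>C\<^esub> g = Id C B}"

locale cat_functor = C: category C + D: category D
  for C :: "('o, 'a) category" and D :: "('p, 'b) category" +
  fixes Fo :: "'o \<Rightarrow> 'p" and Fa :: "'a \<Rightarrow> 'b"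
  assumes Fo_Obj: "A \<in> Obj C \<Longrightarrow> Fo A \<in> Obj D"
    and Fa_Hom: "\<lbrakk>A \<in> Obj C; B \<in> Obj C; f \<in> Hom C A B\<rbrakk> \<Longrightarrow> Fa f \<in> Hom D (Fo A) (Fo B)"
    and Fa_Id: "A \<in> Obj C \<Longrightarrow> Fa (Id C A) = Id D (Fo A)"
    and Fa_Comp:
      "\<lbrakk>A \<in> Obj C; B \<in> Obj C; E \<in> Obj C; f \<in> Hom C A B; g \<in> Hom C B E\<rbrakk> \<Longrightarrow>
        Fa (g \<cdot>\<^bsub>C\<^esub> f) = Fa g \<cdot>\<^bsub>D\<^esub> Fa f"

text \<open>An adjunction \<open>F \<stileturn> G\<close>, given by bijections
  \<open>\<Phi> A X : Hom D (F A) X \<longrightarrow> Hom C A (G X)\<close> natural in \<open>A\<close> and \<open>X\<close>.\<close>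

locale adjunction = F: cat_functor C D Fo Fa + G: cat_functor D C Go Ga
  for C :: "('o, 'a) category" and D :: "('p, 'b) category" and Fo Fa Go Ga +
  fixes \<Phi> :: "'o \<Rightarrow> 'p \<Rightarrow> 'b \<Rightarrow> 'a"
  assumes \<Phi>_bij:
      "\<lbrakk>A \<in> Obj C; X \<in> Obj D\<rbrakk> \<Longrightarrow> bij_betw (\<Phi> A X) (Hom D (Fo A) X) (Hom C A (Go X))"
    and \<Phi>_natural:
      "\<lbrakk>A \<in> Obj C; A' \<in> Obj C; X \<in> Obj D; X' \<in> Obj D;
        h \<in> Hom C A' A; f \<in> Hom D (Fo A) X; k \<in> Hom D X X'\<rbrakk> \<Longrightarrow>
        \<Phi> A' X' (k \<cdot>\<^bsub>D\<^esub> f \<cdot>\<^bsub>D\<^esub> Fa h) = Ga k \<cdot>\<^bsub>C\<^esub> \<Phi> A X f \<cdot>\<^bsub>C\<^esub> h"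

definition has_right_adjoint ::
    "('o, 'a) category \<Rightarrow> ('p, 'b) category \<Rightarrow> ('o \<Rightarrow> 'p) \<Rightarrow> ('a \<Rightarrow> 'b) \<Rightarrow> bool" where
  "has_right_adjoint C D Fo Fa \<longleftrightarrow> (\<exists>Go Ga \<Phi>. adjunction C D Fo Fa Go Ga \<Phi>)"


section \<open>Closed symmetric monoidal structures\<close>

record ('o, 'a) monoidal_data =
  tensor_obj :: "'o \<Rightarrow> 'o \<Rightarrow> 'o"  (infixr \<open>\<and>\<^sub>o\<index>\<close> 60)
  tensor_arr :: "'a \<Rightarrow> 'a \<Rightarrow> 'a"  (infixr \<open>\<and>\<^sub>a\<index>\<close> 60)
  unit_obj :: "'o"
  associator :: "'o \<Rightarrow> 'o \<Rightarrow> 'o \<Rightarrow> 'a"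
  left_unitor :: "'o \<Rightarrow> 'a"
  right_unitor :: "'o \<Rightarrow> 'a"
  braiding :: "'o \<Rightarrow> 'o \<Rightarrow> 'a"

locale symmetric_monoidal = category C
  for C :: "('o, 'a) category" (structure) and T :: "('o, 'a) monoidal_data" (structure) +
  assumes tensor_obj: "\<lbrakk>A \<in> Obj C; B \<in> Obj C\<rbrakk> \<Longrightarrow> A \<and>\<^sub>o\<^bsub>T\<^esub> B \<in> Obj C"
    and tensor_arr:
      "\<lbrakk>A \<in> Obj C; A' \<in> Obj C; B \<in> Obj C; B' \<in> Obj C; f \<in> Hom C A A'; g \<in> Hom C B B'\<rbrakk> \<Longrightarrow>
        f \<and>\<^sub>a\<^bsub>T\<^esub> g \<in> Hom C (A \<and>\<^sub>o\<^bsub>T\<^esub> B) (A' \<and>\<^sub>o\<^bsub>T\<^esub> B')"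
    and tensor_Id:
      "\<lbrakk>A \<in> Obj C; B \<in> Obj C\<rbrakk> \<Longrightarrow> Id C A \<and>\<^sub>a\<^bsub>T\<^esub> Id C B = Id C (A \<and>\<^sub>o\<^bsub>T\<^esub> B)"
    and tensor_Comp:
      "\<lbrakk>A \<in> Obj C; A' \<in> Obj C; A'' \<in> Obj C; B \<in> Obj C; B' \<in> Obj C; B'' \<in> Obj C;
        f \<in> Hom C A A'; f' \<in> Hom C A' A''; g \<in> Hom C B B'; g' \<in> Hom C B' B''\<rbrakk> \<Longrightarrow>
        (f' \<cdot> f) \<and>\<^sub>a\<^bsub>T\<^esub> (g' \<cdot> g) = (f' \<and>\<^sub>a\<^bsub>T\<^esub> g') \<cdot> (f \<and>\<^sub>a\<^bsub>T\<^esub> g)"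
    and unit_obj: "unit_obj T \<in> Obj C"
    and associator_iso:
      "\<lbrakk>A \<in> Obj C; B \<in> Obj C; D \<in> Obj C\<rbrakk> \<Longrightarrow>
        associator T A B D
          \<in> isomorphisms C ((A \<and>\<^sub>o\<^bsub>T\<^esub> B) \<and>\<^sub>o\<^bsub>T\<^esub> D) (A \<and>\<^sub>o\<^bsub>T\<^esub> (B \<and>\<^sub>o\<^bsub>T\<^esub> D))"
    and associator_natural:
      "\<lbrakk>A \<in> Obj C; A' \<in> Obj C; B \<in> Obj C; B' \<in> Obj C; D \<in> Obj C; D' \<in> Obj C;
        f \<in> Hom C A A'; g \<in> Hom C B B'; h \<in> Hom C D D'\<rbrakk> \<Longrightarrow>
        associator T A' B' D' \<cdot> ((f \<and>\<^sub>a\<^bsub>T\<^esub> g) \<and>\<^sub>a\<^bsub>T\<^esub> h)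
          = (f \<and>\<^sub>a\<^bsub>T\<^esub> (g \<and>\<^sub>a\<^bsub>T\<^esub> h)) \<cdot> associator T A B D"
    and left_unitor_iso:
      "A \<in> Obj C \<Longrightarrow> left_unitor T A \<in> isomorphisms C (unit_obj T \<and>\<^sub>o\<^bsub>T\<^esub> A) A"
    and left_unitor_natural:
      "\<lbrakk>A \<in> Obj C; A' \<in> Obj C; f \<in> Hom C A A'\<rbrakk> \<Longrightarrow>
        left_unitor T A' \<cdot> (Id C (unit_obj T) \<and>\<^sub>a\<^bsub>T\<^esub> f) = f \<cdot> left_unitor T A"
    and right_unitor_iso:
      "A \<in> Obj C \<Longrightarrow> right_unitor T A \<in> isomorphisms C (A \<and>\<^sub>o\<^bsub>T\<^esub> unit_obj T) A"
    and right_unitor_natural: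
      "\<lbrakk>A \<in> Obj C; A' \<in> Obj C; f \<in> Hom C A A'\<rbrakk> \<Longrightarrow>
        right_unitor T A' \<cdot> (f \<and>\<^sub>a\<^bsub>T\<^esub> Id C (unit_obj T)) = f \<cdot> right_unitor T A"
    and braiding_iso:
      "\<lbrakk>A \<in> Obj C; B \<in> Obj C\<rbrakk> \<Longrightarrow>
        braiding T A B \<in> isomorphisms C (A \<and>\<^sub>o\<^bsub>T\<^esub> B) (B \<and>\<^sub>o\<^bsub>T\<^esub> A)"
    and braiding_natural:
      "\<lbrakk>A \<in> Obj C; A' \<in> Obj C; B \<in> Obj C; B' \<in> Obj C; f \<in> Hom C A A'; g \<in> Hom C B B'\<rbrakk> \<Longrightarrow>
        braiding T A' B' \<cdot> (f \<and>\<^sub>a\<^bsub>T\<^esub> g) = (g \<and>\<^sub>a\<^bsub>T\<^esub> f) \<cdot> braiding T A B"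
    and pentagon:
      "\<lbrakk>A \<in> Obj C; B \<in> Obj C; D \<in> Obj C; E \<in> Obj C\<rbrakk> \<Longrightarrow>
        associator T A B (D \<and>\<^sub>o\<^bsub>T\<^esub> E) \<cdot> associator T (A \<and>\<^sub>o\<^bsub>T\<^esub> B) D E
          = (Id C A \<and>\<^sub>a\<^bsub>T\<^esub> associator T B D E) \<cdot> associator T A (B \<and>\<^sub>o\<^bsub>T\<^esub> D) E
              \<cdot> (associator T A B D \<and>\<^sub>a\<^bsub>T\<^esub> Id C E)"
    and triangle:
      "\<lbrakk>A \<in> Obj C; B \<in> Obj C\<rbrakk> \<Longrightarrow>
        (Id C A \<and>\<^sub>a\<^bsub>T\<^esub> left_unitor T B) \<cdot> associator T A (unit_obj T) B
          = right_unitor T A \<and>\<^sub>a\<^bsub>T\<^esub> Id C B"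
    and hexagon:
      "\<lbrakk>A \<in> Obj C; B \<in> Obj C; D \<in> Obj C\<rbrakk> \<Longrightarrow>
        associator T B D A \<cdot> braiding T A (B \<and>\<^sub>o\<^bsub>T\<^esub> D) \<cdot> associator T A B D
          = (Id C B \<and>\<^sub>a\<^bsub>T\<^esub> braiding T A D) \<cdot> associator T B A D
              \<cdot> (braiding T A B \<and>\<^sub>a\<^bsub>T\<^esub> Id C D)"
    and symmetry:
      "\<lbrakk>A \<in> Obj C; B \<in> Obj C\<rbrakk> \<Longrightarrow> braiding T B A \<cdot> braiding T A B = Id C (A \<and>\<^sub>o\<^bsub>T\<^esub> B)"

locale closed_symmetric_monoidal = symmetric_monoidal +
  assumes closed:
    "B \<in> Obj C \<Longrightarrow> has_right_adjoint C C (\<lambda>A. A \<and>\<^sub>o\<^bsub>T\<^esub> B) (\<lambda>f. f \<and>\<^sub>a\<^bsub>T\<^esub> Id C B)"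


section \<open>The category of left modules\<close>

text \<open>
  HOL cannot quantify over all carrier types inside a formula, so ``the'' category of left modules
  is formed relative to a universe, as in set theory: all sets live in a type \<open>'u\<close>, and a set
  is small if it has strictly smaller cardinality than \<open>'u\<close>.  The cardinality of \<open>'u\<close> is
  only required to be an infinite strong limit; in particular every Grothendieck universe
  (cardinality an inaccessible cardinal) is covered.
\<close>

definition small :: "'u set \<Rightarrow> bool" where
  "small X \<longleftrightarrow> X \<prec> (UNIV :: 'u set)"

definition universe :: "'u itself \<Rightarrow> bool" where
  "universe _ \<longleftrightarrow> infinite (UNIV :: 'u set) \<and>
     (\<forall>X :: 'u set. small X \<longrightarrow> Pow X \<prec> (UNIV :: 'u set))"

text \<open>Arrows carry their source and target, and the underlying functions are extensional, so
  that equality of arrows is equality of linear maps.\<close>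

datatype ('r, 'a) lmod_arr =
  Arr (src: "('r, 'a) module") (fn: "'a \<Rightarrow> 'a") (tgt: "('r, 'a) module")

definition LMod ::
    "('u, 'z) ring_scheme \<Rightarrow> (('u, 'u) module, ('u, 'u) lmod_arr) category" where
  "LMod R = \<lparr>
     Obj = {M. left_module R M \<and> small (carrier M)},
     Hom = (\<lambda>M N. {Arr M f N | f. f \<in> lmod_hom R M N \<and> f \<in> extensional (carrier M)}),
     Comp = (\<lambda>g f. Arr (src f) (compose (carrier (src f)) (fn g) (fn f)) (tgt g)),
     Id = (\<lambda>M. Arr M (\<lambda>x\<in>carrier M. x) M)\<rparr>"

lemma in_Hom_LMod:
  "h \<in> Hom (LMod R) M N \<longleftrightarrow>
     src h = M \<and> tgt h = N \<and> fn h \<in> lmod_hom R M N \<and> fn h \<in> extensional (carrier M)"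
  by (cases h) (auto simp: LMod_def)

lemma LMod_category: "category (LMod R)"
proof
  show "Id (LMod R) A \<in> Hom (LMod R) A A" if "A \<in> Obj (LMod R)" for A
    using that by (auto simp: in_Hom_LMod)
      (auto simp: LMod_def lmod_hom_def left_module.smult_closed left_module_def
        abelian_group_def abelian_monoid.a_closed)
  show "g \<cdot>\<^bsub>LMod R\<^esub> f \<in> Hom (LMod R) A D"
    if "A \<in> Obj (LMod R)" "f \<in> Hom (LMod R) A B" "g \<in> Hom (LMod R) B D" for A B D f g
    using that by (auto simp: in_Hom_LMod)
      (auto simp: LMod_def lmod_hom_def compose_def Pi_iff left_module.smult_closed left_module_def
        abelian_group_def abelian_monoid.a_closed)
qed (auto simp: LMod_def lmod_hom_def compose_def Pi_iff fun_eq_iff extensional_def)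

definition arr_add :: "('r, 'a) lmod_arr \<Rightarrow> ('r, 'a) lmod_arr \<Rightarrow> ('r, 'a) lmod_arr" where
  "arr_add f g = Arr (src f) (\<lambda>x\<in>carrier (src f). fn f x \<oplus>\<^bsub>tgt f\<^esub> fn g x) (tgt f)"

definition additive_functor ::
    "('u, 'z) ring_scheme \<Rightarrow> (('u, 'u) lmod_arr \<Rightarrow> ('u, 'u) lmod_arr) \<Rightarrow> bool" where
  "additive_functor R Fa \<longleftrightarrow>
     (\<forall>M\<in>Obj (LMod R). \<forall>N\<in>Obj (LMod R). \<forall>f\<in>Hom (LMod R) M N. \<forall>g\<in>Hom (LMod R) M N.
        Fa (arr_add f g) = arr_add (Fa f) (Fa g))"

definition additive_tensor ::
    "('u, 'z) ring_scheme \<Rightarrow> (('u, 'u) module, ('u, 'u) lmod_arr) monoidal_data \<Rightarrow> bool" where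
  "additive_tensor R T \<longleftrightarrow>
     (\<forall>B\<in>Obj (LMod R). additive_functor R (\<lambda>f. f \<and>\<^sub>a\<^bsub>T\<^esub> Id (LMod R) B) \<and>
                        additive_functor R (\<lambda>f. Id (LMod R) B \<and>\<^sub>a\<^bsub>T\<^esub> f))"


section \<open>Two-fold bimodules and the tensor product over them\<close>

locale right_action = left_module R \<Lambda>
  for R (structure) and \<Lambda> (structure) and act :: "'b \<Rightarrow> 'a \<Rightarrow> 'b" +
  assumes act_closed:
      "\<lbrakk>l \<in> carrier \<Lambda>; r \<in> carrier R\<rbrakk> \<Longrightarrow> act l r \<in> carrier \<Lambda>"
    and act_l_distr:
      "\<lbrakk>l \<in> carrier \<Lambda>; l' \<in> carrier \<Lambda>; r \<in> carrier R\<rbrakk> \<Longrightarrow>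
        act (l \<oplus>\<^bsub>\<Lambda>\<^esub> l') r = act l r \<oplus>\<^bsub>\<Lambda>\<^esub> act l' r"
    and act_r_distr:
      "\<lbrakk>l \<in> carrier \<Lambda>; r \<in> carrier R; s \<in> carrier R\<rbrakk> \<Longrightarrow>
        act l (r \<oplus> s) = act l r \<oplus>\<^bsub>\<Lambda>\<^esub> act l s"
    and act_assoc:
      "\<lbrakk>l \<in> carrier \<Lambda>; r \<in> carrier R; s \<in> carrier R\<rbrakk> \<Longrightarrow> act l (r \<otimes> s) = act (act l r) s"
    and act_one: "l \<in> carrier \<Lambda> \<Longrightarrow> act l \<one> = l"
    and act_smult:
      "\<lbrakk>l \<in> carrier \<Lambda>; r \<in> carrier R; s \<in> carrier R\<rbrakk> \<Longrightarrow>
        act (s \<odot>\<^bsub>\<Lambda>\<^esub> l) r = s \<odot>\<^bsub>\<Lambda>\<^esub> act l r"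

locale twofold_bimodule = one: right_action R \<Lambda> act1 + two: right_action R \<Lambda> act2
  for R (structure) and \<Lambda> (structure) and act1 act2 +
  assumes acts_commute:
    "\<lbrakk>l \<in> carrier \<Lambda>; r \<in> carrier R; s \<in> carrier R\<rbrakk> \<Longrightarrow> act2 (act1 l r) s = act1 (act2 l s) r"

text \<open>\<open>\<Lambda>\<^bsub>B,A\<^esub> \<otimes> A \<otimes> B\<close> is the free abelian group on the triples \<open>(\<lambda>, a, b)\<close> modulo the
  subgroup generated by the following elements: the first three families present
  \<open>\<Lambda> \<otimes>\<^sub>\<int> A \<otimes>\<^sub>\<int> B\<close>, the last two impose the balancing relations.\<close>

inductive_set tensor3_rels ::
    "('r, 'z) ring_scheme \<Rightarrow> ('r, 'l) module \<Rightarrow> ('l \<Rightarrow> 'r \<Rightarrow> 'l) \<Rightarrow> ('l \<Rightarrow> 'r \<Rightarrow> 'l) \<Rightarrow>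
     ('r, 'a) module \<Rightarrow> ('r, 'b) module \<Rightarrow> (('l \<times> 'a \<times> 'b) \<Rightarrow>\<^sub>0 int) set"
  for R \<Lambda> act1 act2 A B where
  "\<lbrakk>l \<in> carrier \<Lambda>; l' \<in> carrier \<Lambda>; a \<in> carrier A; b \<in> carrier B\<rbrakk> \<Longrightarrow>
     frag_of (l \<oplus>\<^bsub>\<Lambda>\<^esub> l', a, b) - (frag_of (l, a, b) + frag_of (l', a, b))
       \<in> tensor3_rels R \<Lambda> act1 act2 A B"
| "\<lbrakk>l \<in> carrier \<Lambda>; a \<in> carrier A; a' \<in> carrier A; b \<in> carrier B\<rbrakk> \<Longrightarrow>
     frag_of (l, a \<oplus>\<^bsub>A\<^esub> a', b) - (frag_of (l, a, b) + frag_of (l, a', b))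
       \<in> tensor3_rels R \<Lambda> act1 act2 A B"
| "\<lbrakk>l \<in> carrier \<Lambda>; a \<in> carrier A; b \<in> carrier B; b' \<in> carrier B\<rbrakk> \<Longrightarrow>
     frag_of (l, a, b \<oplus>\<^bsub>B\<^esub> b') - (frag_of (l, a, b) + frag_of (l, a, b'))
       \<in> tensor3_rels R \<Lambda> act1 act2 A B"
| "\<lbrakk>l \<in> carrier \<Lambda>; r \<in> carrier R; a \<in> carrier A; b \<in> carrier B\<rbrakk> \<Longrightarrow>
     frag_of (act1 l r, a, b) - frag_of (l, a, r \<odot>\<^bsub>B\<^esub> b) \<in> tensor3_rels R \<Lambda> act1 act2 A B"
| "\<lbrakk>l \<in> carrier \<Lambda>; r \<in> carrier R; a \<in> carrier A; b \<in> carrier B\<rbrakk> \<Longrightarrow>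
     frag_of (act2 l r, a, b) - frag_of (l, r \<odot>\<^bsub>A\<^esub> a, b) \<in> tensor3_rels R \<Lambda> act1 act2 A B"

definition tensor3_free ::
    "('r, 'l) module \<Rightarrow> ('r, 'a) module \<Rightarrow> ('r, 'b) module \<Rightarrow> (('l \<times> 'a \<times> 'b) \<Rightarrow>\<^sub>0 int) monoid" where
  "tensor3_free \<Lambda> A B = free_Abelian_group (carrier \<Lambda> \<times> carrier A \<times> carrier B)"

definition tensor3_ker ::
    "('r, 'z) ring_scheme \<Rightarrow> ('r, 'l) module \<Rightarrow> ('l \<Rightarrow> 'r \<Rightarrow> 'l) \<Rightarrow> ('l \<Rightarrow> 'r \<Rightarrow> 'l) \<Rightarrow>
     ('r, 'a) module \<Rightarrow> ('r, 'b) module \<Rightarrow> (('l \<times> 'a \<times> 'b) \<Rightarrow>\<^sub>0 int) set" where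
  "tensor3_ker R \<Lambda> act1 act2 A B =
     generate (tensor3_free \<Lambda> A B) (tensor3_rels R \<Lambda> act1 act2 A B)"

text \<open>The map on cosets induced by the additive extension of
  \<open>(\<lambda>, a, b) \<mapsto> (u \<lambda>, f a, g b)\<close>; here \<open>K\<close> is the kernel on the target side, and all the
  united cosets coincide whenever the map is well defined.\<close>

definition tensor3_induced ::
    "(('l \<times> 'a \<times> 'b) \<Rightarrow>\<^sub>0 int) set \<Rightarrow> (('l \<times> 'a \<times> 'b) \<Rightarrow>\<^sub>0 int) monoid \<Rightarrow>
     ('k \<Rightarrow> 'l) \<Rightarrow> ('c \<Rightarrow> 'a) \<Rightarrow> ('d \<Rightarrow> 'b) \<Rightarrow>
     (('k \<times> 'c \<times> 'd) \<Rightarrow>\<^sub>0 int) set \<Rightarrow> (('l \<times> 'a \<times> 'b) \<Rightarrow>\<^sub>0 int) set" where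
  "tensor3_induced K G u f g X =
     (\<Union>x\<in>X. K #>\<^bsub>G\<^esub> frag_extend (\<lambda>(l, a, b). frag_of (u l, f a, g b)) x)"

text \<open>The fields \<open>mult\<close> and \<open>one\<close> play no role in a module.\<close>

definition tensor3 ::
    "('r, 'z) ring_scheme \<Rightarrow> ('r, 'l) module \<Rightarrow> ('l \<Rightarrow> 'r \<Rightarrow> 'l) \<Rightarrow> ('l \<Rightarrow> 'r \<Rightarrow> 'l) \<Rightarrow>
     ('r, 'a) module \<Rightarrow> ('r, 'b) module \<Rightarrow> ('r, (('l \<times> 'a \<times> 'b) \<Rightarrow>\<^sub>0 int) set) module" where
  "tensor3 R \<Lambda> act1 act2 A B =
     (let G = tensor3_free \<Lambda> A B; K = tensor3_ker R \<Lambda> act1 act2 A B in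
      \<lparr>carrier = carrier (G Mod K), mult = undefined, one = undefined,
       ring.zero = \<one>\<^bsub>G Mod K\<^esub>, add = mult (G Mod K),
       smult = (\<lambda>r. tensor3_induced K G (\<lambda>l. r \<odot>\<^bsub>\<Lambda>\<^esub> l) (\<lambda>a. a) (\<lambda>b. b))\<rparr>)"

definition tensor3_map ::
    "('r, 'z) ring_scheme \<Rightarrow> ('r, 'l) module \<Rightarrow> ('l \<Rightarrow> 'r \<Rightarrow> 'l) \<Rightarrow> ('l \<Rightarrow> 'r \<Rightarrow> 'l) \<Rightarrow>
     ('r, 'a) lmod_arr \<Rightarrow> ('r, 'b) lmod_arr \<Rightarrow>
     (('l \<times> 'a \<times> 'b) \<Rightarrow>\<^sub>0 int) set \<Rightarrow> (('l \<times> 'a \<times> 'b) \<Rightarrow>\<^sub>0 int) set" where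
  "tensor3_map R \<Lambda> act1 act2 f g =
     tensor3_induced (tensor3_ker R \<Lambda> act1 act2 (tgt f) (tgt g)) (tensor3_free \<Lambda> (tgt f) (tgt g))
       (\<lambda>l. l) (fn f) (fn g)"

text \<open>With these operations \<open>tensor3\<close> is a bifunctor with values in left modules.\<close>

lemma tensor3_ker_normal:
  assumes "twofold_bimodule R \<Lambda> act1 act2" "left_module R A" "left_module R B"
  shows "tensor3_ker R \<Lambda> act1 act2 A B \<lhd> tensor3_free \<Lambda> A B"
proof -
  interpret L: twofold_bimodule R \<Lambda> act1 act2 by fact
  interpret A: left_module R A by fact
  interpret B: left_module R B by fact
  interpret G: comm_group "tensor3_free \<Lambda> A B"
    by (simp add: tensor3_free_def abelian_free_Abelian_group)
  have *: "frag_of (l, a, b) \<in> carrier (tensor3_free \<Lambda> A B)"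
    if "l \<in> carrier \<Lambda>" "a \<in> carrier A" "b \<in> carrier B" for l a b
    using that by (simp add: tensor3_free_def)
  have mi: "x + y \<in> carrier (tensor3_free \<Lambda> A B)" "x - y \<in> carrier (tensor3_free \<Lambda> A B)"
    if "x \<in> carrier (tensor3_free \<Lambda> A B)" "y \<in> carrier (tensor3_free \<Lambda> A B)" for x y
    using that keys_add[of x y] keys_diff[of x y] by (auto simp: tensor3_free_def)
  have "tensor3_rels R \<Lambda> act1 act2 A B \<subseteq> carrier (tensor3_free \<Lambda> A B)"
  proof
    fix x assume "x \<in> tensor3_rels R \<Lambda> act1 act2 A B"
    then show "x \<in> carrier (tensor3_free \<Lambda> A B)"
      by cases (auto intro!: mi * L.one.act_closed L.two.act_closed A.smult_closed B.smult_closed)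
  qed
  then have "subgroup (tensor3_ker R \<Lambda> act1 act2 A B) (tensor3_free \<Lambda> A B)"
    unfolding tensor3_ker_def by (rule G.generate_is_subgroup)
  then show ?thesis by (rule G.subgroup_imp_normal)
qed

lemma frag_extend_ker:
  fixes E :: "('l \<times> 'a \<times> 'b \<Rightarrow>\<^sub>0 int) \<Rightarrow> ('k \<times> 'c \<times> 'd \<Rightarrow>\<^sub>0 int)"
  assumes L: "twofold_bimodule R \<Lambda> act1 act2" "left_module R A" "left_module R B"
    and L': "twofold_bimodule R \<Lambda>' act1' act2'" "left_module R A'" "left_module R B'"
    and u: "u \<in> carrier \<Lambda> \<rightarrow> carrier \<Lambda>'"
      "\<And>x y. x \<in> carrier \<Lambda> \<Longrightarrow> y \<in> carrier \<Lambda> \<Longrightarrow> u (x \<oplus>\<^bsub>\<Lambda>\<^esub> y) = u x \<oplus>\<^bsub>\<Lambda>'\<^esub> u y"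
      "\<And>x r. x \<in> carrier \<Lambda> \<Longrightarrow> r \<in> carrier R \<Longrightarrow> u (act1 x r) = act1' (u x) r"
      "\<And>x r. x \<in> carrier \<Lambda> \<Longrightarrow> r \<in> carrier R \<Longrightarrow> u (act2 x r) = act2' (u x) r"
    and f: "f \<in> lmod_hom R A A'" and g: "g \<in> lmod_hom R B B'"
  defines "E \<equiv> frag_extend (\<lambda>(l, a, b). frag_of (u l, f a, g b))"
  shows "x \<in> carrier (tensor3_free \<Lambda> A B) \<Longrightarrow> E x \<in> carrier (tensor3_free \<Lambda>' A' B')"
    and "x \<in> tensor3_ker R \<Lambda> act1 act2 A B \<Longrightarrow> E x \<in> tensor3_ker R \<Lambda>' act1' act2' A' B'"
proof -
  interpret L: twofold_bimodule R \<Lambda> act1 act2 by fact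
  interpret A: left_module R A by fact
  interpret B: left_module R B by fact
  show c: "E x \<in> carrier (tensor3_free \<Lambda>' A' B')" if "x \<in> carrier (tensor3_free \<Lambda> A B)" for x
    unfolding tensor3_free_def E_def carrier_free_Abelian_group_iff
    by (rule order.trans[OF keys_frag_extend])
      (use that u f g in \<open>fastforce simp: tensor3_free_def lmod_hom_def\<close>)
  have E_add: "E (x + y) = E x + E y" "E (x - y) = E x - E y" "E (- x) = - E x" "E 0 = 0" for x y
    by (simp_all add: E_def frag_extend_add frag_extend_diff frag_extend_minus)
  have E_of: "E (frag_of (l, a, b)) = frag_of (u l, f a, g b)" for l a b
    by (simp add: E_def)
  interpret K: normal "tensor3_ker R \<Lambda> act1 act2 A B" "tensor3_free \<Lambda> A B"
    by (rule tensor3_ker_normal[OF L])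
  interpret K': normal "tensor3_ker R \<Lambda>' act1' act2' A' B'" "tensor3_free \<Lambda>' A' B'"
    by (rule tensor3_ker_normal[OF L'])
  have inv': "inv\<^bsub>tensor3_free \<Lambda>' A' B'\<^esub> x = - x" if "x \<in> carrier (tensor3_free \<Lambda>' A' B')" for x
    using that by (simp add: tensor3_free_def)
  have rel: "E x \<in> tensor3_ker R \<Lambda>' act1' act2' A' B'" if "x \<in> tensor3_rels R \<Lambda> act1 act2 A B" for x
    unfolding tensor3_ker_def
    by (rule generate.incl, use that in cases)
       (use f g u in \<open>auto simp: E_add E_of lmod_hom_def Pi_iff intro: tensor3_rels.intros\<close>)
  show "E x \<in> tensor3_ker R \<Lambda>' act1' act2' A' B'" if "x \<in> tensor3_ker R \<Lambda> act1 act2 A B"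
    using that[unfolded tensor3_ker_def]
  proof (induction rule: generate.induct)
    case one
    then show ?case using subgroup.one_closed[OF K'.subgroup_axioms] unfolding tensor3_free_def by (simp add: E_add)
  next
    case (incl h) then show ?case by (rule rel)
  next
    case (inv h)
    have "h \<in> carrier (tensor3_free \<Lambda> A B)"
      using K.subset generate.incl[OF inv] by (auto simp: tensor3_ker_def)
    then have e: "inv\<^bsub>tensor3_free \<Lambda> A B\<^esub> h = - h" by (simp add: tensor3_free_def)
    have r: "E h \<in> tensor3_ker R \<Lambda>' act1' act2' A' B'" using inv by (rule rel)
    have "inv\<^bsub>tensor3_free \<Lambda>' A' B'\<^esub> (E h) = - E h"
      using K'.mem_carrier[OF r] by (rule inv')
    then show ?case using subgroup.m_inv_closed[OF K'.subgroup_axioms r] by (simp add: e E_add)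
  next
    case (eng h1 h2)
    then show ?case using subgroup.m_closed[OF K'.subgroup_axioms eng.IH] unfolding tensor3_free_def by (simp add: E_add)
  qed
qed

lemma tensor3_induced_coset:
  assumes L: "twofold_bimodule R \<Lambda> act1 act2" "left_module R A" "left_module R B"
    and L': "twofold_bimodule R \<Lambda>' act1' act2'" "left_module R A'" "left_module R B'"
    and u: "u \<in> carrier \<Lambda> \<rightarrow> carrier \<Lambda>'"
      "\<And>x y. x \<in> carrier \<Lambda> \<Longrightarrow> y \<in> carrier \<Lambda> \<Longrightarrow> u (x \<oplus>\<^bsub>\<Lambda>\<^esub> y) = u x \<oplus>\<^bsub>\<Lambda>'\<^esub> u y"
      "\<And>x r. x \<in> carrier \<Lambda> \<Longrightarrow> r \<in> carrier R \<Longrightarrow> u (act1 x r) = act1' (u x) r"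
      "\<And>x r. x \<in> carrier \<Lambda> \<Longrightarrow> r \<in> carrier R \<Longrightarrow> u (act2 x r) = act2' (u x) r"
    and f: "f \<in> lmod_hom R A A'" and g: "g \<in> lmod_hom R B B'"
    and x: "x \<in> carrier (tensor3_free \<Lambda> A B)"
  shows "tensor3_induced (tensor3_ker R \<Lambda>' act1' act2' A' B') (tensor3_free \<Lambda>' A' B') u f g
           (tensor3_ker R \<Lambda> act1 act2 A B #>\<^bsub>tensor3_free \<Lambda> A B\<^esub> x)
       = tensor3_ker R \<Lambda>' act1' act2' A' B' #>\<^bsub>tensor3_free \<Lambda>' A' B'\<^esub>
           frag_extend (\<lambda>(l, a, b). frag_of (u l, f a, g b)) x"
    (is "tensor3_induced ?K' ?G' u f g (?K #>\<^bsub>?G\<^esub> x) = _ #>\<^bsub>_\<^esub> ?E x")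
proof -
  interpret K: normal ?K ?G by (rule tensor3_ker_normal[OF L])
  interpret K': normal ?K' ?G' by (rule tensor3_ker_normal[OF L'])
  have E: "?E y \<in> carrier ?G'" if "y \<in> carrier ?G" for y
    using L L' u f g that by (rule frag_extend_ker(1)[where u = u and f = f and g = g])
  have E': "?E y \<in> ?K'" if "y \<in> ?K" for y
    using L L' u f g that by (rule frag_extend_ker(2)[where u = u and f = f and g = g])
  have "?K' #>\<^bsub>?G'\<^esub> ?E (k \<otimes>\<^bsub>?G\<^esub> x) = ?K' #>\<^bsub>?G'\<^esub> ?E x" if "k \<in> ?K" for k
  proof -
    have "?E (k \<otimes>\<^bsub>?G\<^esub> x) = ?E k \<otimes>\<^bsub>?G'\<^esub> ?E x"
      by (simp add: tensor3_free_def frag_extend_add)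
    then show ?thesis
      using E[OF x] E'[OF that] K'.mem_carrier
      by (simp flip: K'.coset_mult_assoc add: K'.coset_join2 K'.subgroup_axioms K'.subset)
  qed
  moreover have "?K \<noteq> {}" using subgroup.one_closed[OF K.subgroup_axioms] by blast
  ultimately show ?thesis by (auto simp: tensor3_induced_def r_coset_def)
qed

lemma tensor3_left_module:
  fixes \<Lambda> :: "('r, 'l) module" and A :: "('r, 'a) module" and B :: "('r, 'b) module"
  assumes L: "twofold_bimodule R \<Lambda> act1 act2" "left_module R A" "left_module R B"
  shows "left_module R (tensor3 R \<Lambda> act1 act2 A B)"
proof -
  interpret L: twofold_bimodule R \<Lambda> act1 act2 by fact
  let ?K = "tensor3_ker R \<Lambda> act1 act2 A B"
  let ?G = "tensor3_free \<Lambda> A B"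
  interpret K: normal ?K ?G by (rule tensor3_ker_normal[OF L])
  interpret G: comm_group ?G by (simp add: tensor3_free_def abelian_free_Abelian_group)
  interpret Q: comm_group "?G Mod ?K" by (rule G.abelian_FactGroup[OF K.subgroup_axioms])
  define E :: "'r \<Rightarrow> ('l \<times> 'a \<times> 'b \<Rightarrow>\<^sub>0 int) \<Rightarrow> ('l \<times> 'a \<times> 'b \<Rightarrow>\<^sub>0 int)"
    where "E r = frag_extend (\<lambda>(l, a, b). frag_of (r \<odot>\<^bsub>\<Lambda>\<^esub> l, (\<lambda>a. a) a, (\<lambda>b. b) b))" for r
  have id: "(\<lambda>a. a) \<in> lmod_hom R M M" for M :: "(_,'m) module" by (simp add: lmod_hom_def)
  have sm: "r \<odot>\<^bsub>tensor3 R \<Lambda> act1 act2 A B\<^esub> (?K #>\<^bsub>?G\<^esub> x) = ?K #>\<^bsub>?G\<^esub> E r x"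
    and Ec: "E r x \<in> carrier ?G"
    if "r \<in> carrier R" "x \<in> carrier ?G" for r x
  proof -
    show "r \<odot>\<^bsub>tensor3 R \<Lambda> act1 act2 A B\<^esub> (?K #>\<^bsub>?G\<^esub> x) = ?K #>\<^bsub>?G\<^esub> E r x"
      unfolding E_def using that
      by (subst tensor3_induced_coset[OF L L _ _ _ _ id id that(2), symmetric])
         (auto simp: tensor3_def Let_def L.one.smult_closed L.one.smult_r_distr
            L.one.act_smult L.two.act_smult)
    show "E r x \<in> carrier ?G"
      unfolding E_def using that
      by (intro frag_extend_ker(1)[OF L L _ _ _ _ id id that(2)])
         (auto simp: L.one.smult_closed L.one.smult_r_distr L.one.act_smult L.two.act_smult)
  qed
  have mul: "(?K #>\<^bsub>?G\<^esub> x) \<oplus>\<^bsub>tensor3 R \<Lambda> act1 act2 A B\<^esub> (?K #>\<^bsub>?G\<^esub> y) = ?K #>\<^bsub>?G\<^esub> (x + y)"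
    if "x \<in> carrier ?G" "y \<in> carrier ?G" for x y
    using K.rcos_sum[OF that] by (simp add: tensor3_def Let_def tensor3_free_def)
  have car: "carrier (tensor3 R \<Lambda> act1 act2 A B) = (\<lambda>x. ?K #>\<^bsub>?G\<^esub> x) ` carrier ?G"
    by (simp add: tensor3_def Let_def carrier_FactGroup)
  have ag: "abelian_group (tensor3 R \<Lambda> act1 act2 A B)"
    by (rule abelian_groupI)
      (use Q.m_closed Q.one_closed Q.m_assoc Q.m_comm Q.l_one Q.l_inv_ex in
        \<open>auto simp: tensor3_def Let_def simp del: mult_FactGroup one_FactGroup\<close>)
  have Eadd: "E r (x + y) = E r x + E r y" for r x y by (simp add: E_def frag_extend_add)
  have pl: "x + y \<in> carrier ?G" if "x \<in> carrier ?G" "y \<in> carrier ?G" for x y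
    using that keys_add[of x y] by (auto simp: tensor3_free_def)
  have E1: "E \<one>\<^bsub>R\<^esub> x = x" if "x \<in> carrier ?G" for x
    apply (subst (2) frag_expansion[of x])
    unfolding E_def
    by (rule frag_extend_eq) (use that L.one.smult_one in \<open>auto simp: tensor3_free_def\<close>)
  have E2: "E (r \<otimes>\<^bsub>R\<^esub> s) x = E r (E s x)"
    if "r \<in> carrier R" "s \<in> carrier R" "x \<in> carrier ?G" for r s x
    using that(3)[unfolded tensor3_free_def carrier_free_Abelian_group_iff]
    by (induction rule: frag_induction)
      (use that in \<open>auto simp: E_def frag_extend_diff L.one.smult_assoc\<close>)
  have E3: "?K #>\<^bsub>?G\<^esub> E (r \<oplus>\<^bsub>R\<^esub> s) x = ?K #>\<^bsub>?G\<^esub> (E r x + E s x)"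
    if rs: "r \<in> carrier R" "s \<in> carrier R" "x \<in> carrier ?G" for r s x
  proof -
    have rs': "r \<oplus>\<^bsub>R\<^esub> s \<in> carrier R" using rs by simp
    have mem: "E (r \<oplus>\<^bsub>R\<^esub> s) x - (E r x + E s x) \<in> ?K"
      using that(3)[unfolded tensor3_free_def carrier_free_Abelian_group_iff]
    proof (induction rule: frag_induction)
      case zero show ?case using subgroup.one_closed[OF K.subgroup_axioms] by (simp add: E_def tensor3_free_def)
    next
      case (one t)
      then show ?case unfolding tensor3_ker_def using rs
        by (intro generate.incl)
          (auto simp: E_def L.one.smult_l_distr L.one.smult_closed intro!: tensor3_rels.intros(1))
    next
      case (diff a b)
      have "b' \<in> ?K \<Longrightarrow> - b' \<in> ?K" for b'
        using subgroup.m_inv_closed[OF K.subgroup_axioms, of b'] K.mem_carrier[of b'] by (simp add: tensor3_free_def)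
      then have "(E (r \<oplus>\<^bsub>R\<^esub> s) a - (E r a + E s a)) + - (E (r \<oplus>\<^bsub>R\<^esub> s) b - (E r b + E s b)) \<in> ?K"
        using subgroup.m_closed[OF K.subgroup_axioms diff(1) \<open>\<And>b'. b' \<in> ?K \<Longrightarrow> - b' \<in> ?K\<close>[OF diff(2)]]
        by (simp only: tensor3_free_def mult_free_Abelian_group)
      then show ?case by (simp add: E_def frag_extend_diff algebra_simps)
    qed
    have "E (r \<oplus>\<^bsub>R\<^esub> s) x = (E (r \<oplus>\<^bsub>R\<^esub> s) x - (E r x + E s x)) \<otimes>\<^bsub>?G\<^esub> (E r x + E s x)"
      by (simp add: tensor3_free_def)
    also have "?K #>\<^bsub>?G\<^esub> \<dots> = ?K #>\<^bsub>?G\<^esub> (E r x + E s x)"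
      using mem K.mem_carrier[OF mem] pl Ec rs
      by (simp flip: K.coset_mult_assoc add: K.coset_join2 K.subgroup_axioms K.subset)
    finally show ?thesis .
  qed
  show ?thesis
    by (intro left_module.intro ag left_module_axioms.intro L.one.ring_axioms)
      (auto simp: car sm mul Ec pl Eadd E1 E2 E3)
qed

lemma tensor3_map_coset:
  assumes L: "twofold_bimodule R \<Lambda> act1 act2" and A: "left_module R A" "left_module R A'"
    and B: "left_module R B" "left_module R B'"
    and f: "f \<in> Hom (LMod R) A A'" and g: "g \<in> Hom (LMod R) B B'"
    and x: "x \<in> carrier (tensor3_free \<Lambda> A B)"
  shows "tensor3_map R \<Lambda> act1 act2 f g (tensor3_ker R \<Lambda> act1 act2 A B #>\<^bsub>tensor3_free \<Lambda> A B\<^esub> x)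
    = tensor3_ker R \<Lambda> act1 act2 A' B' #>\<^bsub>tensor3_free \<Lambda> A' B'\<^esub>
        frag_extend (\<lambda>(l, a, b). frag_of (l, fn f a, fn g b)) x"
    and "frag_extend (\<lambda>(l, a, b). frag_of (l, fn f a, fn g b)) x \<in> carrier (tensor3_free \<Lambda> A' B')"
proof -
  have fg: "fn f \<in> lmod_hom R A A'" "fn g \<in> lmod_hom R B B'" "tgt f = A'" "tgt g = B'"
    using f g by (auto simp: in_Hom_LMod)
  show "tensor3_map R \<Lambda> act1 act2 f g (tensor3_ker R \<Lambda> act1 act2 A B #>\<^bsub>tensor3_free \<Lambda> A B\<^esub> x)
    = tensor3_ker R \<Lambda> act1 act2 A' B' #>\<^bsub>tensor3_free \<Lambda> A' B'\<^esub>
        frag_extend (\<lambda>(l, a, b). frag_of (l, fn f a, fn g b)) x"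
    unfolding tensor3_map_def fg(3,4)
    by (rule tensor3_induced_coset[OF L A(1) B(1) L A(2) B(2) _ _ _ _ fg(1,2) x]) auto
  show "frag_extend (\<lambda>(l, a, b). frag_of (l, fn f a, fn g b)) x \<in> carrier (tensor3_free \<Lambda> A' B')"
    by (rule frag_extend_ker(1)[OF L A(1) B(1) L A(2) B(2) _ _ _ _ fg(1,2) x]) auto
qed

lemma carrier_tensor3:
  "carrier (tensor3 R \<Lambda> act1 act2 A B) =
     (\<lambda>x. tensor3_ker R \<Lambda> act1 act2 A B #>\<^bsub>tensor3_free \<Lambda> A B\<^esub> x) ` carrier (tensor3_free \<Lambda> A B)"
  by (simp add: tensor3_def Let_def carrier_FactGroup)

lemma tensor3_map_hom:
  assumes L: "twofold_bimodule R \<Lambda> act1 act2" and A: "left_module R A" "left_module R A'"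
    and B: "left_module R B" "left_module R B'"
    and f: "f \<in> Hom (LMod R) A A'" and g: "g \<in> Hom (LMod R) B B'"
  shows "tensor3_map R \<Lambda> act1 act2 f g
    \<in> lmod_hom R (tensor3 R \<Lambda> act1 act2 A B) (tensor3 R \<Lambda> act1 act2 A' B')"
proof -
  interpret L: twofold_bimodule R \<Lambda> act1 act2 by fact
  let ?E = "frag_extend (\<lambda>(l, a, b). frag_of (l, fn f a, fn g b))"
  let ?S = "\<lambda>r. frag_extend (\<lambda>(l, a, b). frag_of (r \<odot>\<^bsub>\<Lambda>\<^esub> l, a, b))"
  note m = tensor3_map_coset[OF L A B f g]
  have add: "(tensor3_ker R \<Lambda> act1 act2 A B #>\<^bsub>tensor3_free \<Lambda> A B\<^esub> x)
      \<oplus>\<^bsub>tensor3 R \<Lambda> act1 act2 A B\<^esub> (tensor3_ker R \<Lambda> act1 act2 A B #>\<^bsub>tensor3_free \<Lambda> A B\<^esub> y)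
      = tensor3_ker R \<Lambda> act1 act2 A B #>\<^bsub>tensor3_free \<Lambda> A B\<^esub> (x + y)"
    if "left_module R A" "left_module R B"
      "x \<in> carrier (tensor3_free \<Lambda> A B)" "y \<in> carrier (tensor3_free \<Lambda> A B)" for A B x y
    using normal.rcos_sum[OF tensor3_ker_normal[OF L that(1,2)] that(3,4)]
    by (simp add: tensor3_def Let_def tensor3_free_def)
  have smult: "r \<odot>\<^bsub>tensor3 R \<Lambda> act1 act2 A B\<^esub>
        (tensor3_ker R \<Lambda> act1 act2 A B #>\<^bsub>tensor3_free \<Lambda> A B\<^esub> x)
      = tensor3_ker R \<Lambda> act1 act2 A B #>\<^bsub>tensor3_free \<Lambda> A B\<^esub> ?S r x"
      and S_closed: "?S r x \<in> carrier (tensor3_free \<Lambda> A B)"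
    if AB: "left_module R A" "left_module R B"
      and r: "r \<in> carrier R" and x: "x \<in> carrier (tensor3_free \<Lambda> A B)"
    for A :: "(_, 'm) module" and B :: "(_, 'n) module" and r x
  proof -
    have id: "(\<lambda>a. a) \<in> lmod_hom R M M" for M :: "(_, 'k) module" by (simp add: lmod_hom_def)
    note * = L.one.smult_closed L.one.smult_r_distr L.one.act_smult L.two.act_smult
    show "r \<odot>\<^bsub>tensor3 R \<Lambda> act1 act2 A B\<^esub>
        (tensor3_ker R \<Lambda> act1 act2 A B #>\<^bsub>tensor3_free \<Lambda> A B\<^esub> x)
      = tensor3_ker R \<Lambda> act1 act2 A B #>\<^bsub>tensor3_free \<Lambda> A B\<^esub> ?S r x"
      using r by (subst tensor3_induced_coset[OF L AB L AB _ _ _ _ id id x, symmetric])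
        (auto simp: tensor3_def Let_def *)
    show "?S r x \<in> carrier (tensor3_free \<Lambda> A B)"
      using r by (intro frag_extend_ker(1)[OF L AB L AB _ _ _ _ id id x]) (auto simp: *)
  qed
  have plus: "x + y \<in> carrier (tensor3_free \<Lambda> A B)"
    if "x \<in> carrier (tensor3_free \<Lambda> A B)" "y \<in> carrier (tensor3_free \<Lambda> A B)" for x y
    using that keys_add[of x y] by (auto simp: tensor3_free_def)
  have comm: "?E (?S r x) = ?S r (?E x)" for r x
    using subset_UNIV by (induction x rule: frag_induction) (auto simp: frag_extend_diff)
  show ?thesis
    unfolding lmod_hom_def
    by (auto simp: carrier_tensor3 add smult S_closed plus m A B comm frag_extend_add)
qed

lemma tensor3_map_Id:
  assumes L: "twofold_bimodule R \<Lambda> act1 act2"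
    and A: "A \<in> Obj (LMod R)" and B: "B \<in> Obj (LMod R)"
    and X: "X \<in> carrier (tensor3 R \<Lambda> act1 act2 A B)"
  shows "tensor3_map R \<Lambda> act1 act2 (Id (LMod R) A) (Id (LMod R) B) X = X"
proof -
  have M: "left_module R A" "left_module R B" using A B by (auto simp: LMod_def)
  have I: "Id (LMod R) A \<in> Hom (LMod R) A A" "Id (LMod R) B \<in> Hom (LMod R) B B"
    using A B category.Id_in_Hom[OF LMod_category] by blast+
  obtain x where x: "x \<in> carrier (tensor3_free \<Lambda> A B)"
      and X: "X = tensor3_ker R \<Lambda> act1 act2 A B #>\<^bsub>tensor3_free \<Lambda> A B\<^esub> x"
    using X by (auto simp: carrier_tensor3)
  have "frag_extend (\<lambda>(l, a, b). frag_of (l, fn (Id (LMod R) A) a, fn (Id (LMod R) B) b)) x = x"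
    using x[unfolded tensor3_free_def carrier_free_Abelian_group_iff]
    by (induction x rule: frag_induction) (auto simp: frag_extend_diff LMod_def)
  then show ?thesis
    using tensor3_map_coset(1)[OF L M(1) M(1) M(2) M(2) I x] by (simp add: X)
qed

lemma tensor3_map_Comp:
  assumes L: "twofold_bimodule R \<Lambda> act1 act2"
    and Obj: "A \<in> Obj (LMod R)" "A' \<in> Obj (LMod R)" "A'' \<in> Obj (LMod R)"
      "B \<in> Obj (LMod R)" "B' \<in> Obj (LMod R)" "B'' \<in> Obj (LMod R)"
    and f: "f \<in> Hom (LMod R) A A'" "f' \<in> Hom (LMod R) A' A''"
    and g: "g \<in> Hom (LMod R) B B'" "g' \<in> Hom (LMod R) B' B''"
    and X: "X \<in> carrier (tensor3 R \<Lambda> act1 act2 A B)"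
  shows "tensor3_map R \<Lambda> act1 act2 (f' \<cdot>\<^bsub>LMod R\<^esub> f) (g' \<cdot>\<^bsub>LMod R\<^esub> g) X
    = tensor3_map R \<Lambda> act1 act2 f' g' (tensor3_map R \<Lambda> act1 act2 f g X)"
proof -
  have A: "left_module R A" "left_module R A'" "left_module R A''"
    and B: "left_module R B" "left_module R B'" "left_module R B''"
    using Obj by (auto simp: LMod_def)
  have fg: "f' \<cdot>\<^bsub>LMod R\<^esub> f \<in> Hom (LMod R) A A''" "g' \<cdot>\<^bsub>LMod R\<^esub> g \<in> Hom (LMod R) B B''"
    using category.Comp_in_Hom[OF LMod_category] Obj f g by blast+
  obtain x where x: "x \<in> carrier (tensor3_free \<Lambda> A B)"
      and X: "X = tensor3_ker R \<Lambda> act1 act2 A B #>\<^bsub>tensor3_free \<Lambda> A B\<^esub> x"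
    using X by (auto simp: carrier_tensor3)
  have src: "src f = A" "src g = B" using f g by (auto simp: in_Hom_LMod)
  have "frag_extend (\<lambda>(l, a, b). frag_of (l, fn (f' \<cdot>\<^bsub>LMod R\<^esub> f) a, fn (g' \<cdot>\<^bsub>LMod R\<^esub> g) b)) x
    = frag_extend (\<lambda>(l, a, b). frag_of (l, fn f' a, fn g' b))
        (frag_extend (\<lambda>(l, a, b). frag_of (l, fn f a, fn g b)) x)"
    using x[unfolded tensor3_free_def carrier_free_Abelian_group_iff]
    by (induction x rule: frag_induction) (auto simp: frag_extend_diff LMod_def compose_def src)
  then show ?thesis
    by (simp add: X tensor3_map_coset[OF L A(1,3) B(1,3) fg x]
        tensor3_map_coset[OF L A(1,2) B(1,2) f(1) g(1) x]
        tensor3_map_coset[OF L A(2,3) B(2,3) f(2) g(2)])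
qed


section \<open>The two right structures on \<open>R \<and> R\<close>\<close>

definition right_mult :: "('u, 'z) ring_scheme \<Rightarrow> 'u \<Rightarrow> ('u, 'u) lmod_arr" where
  "right_mult R r =
     Arr (regular_module R) (\<lambda>s\<in>carrier R. s \<otimes>\<^bsub>R\<^esub> r) (regular_module R)"

definition RR ::
    "('u, 'z) ring_scheme \<Rightarrow> (('u, 'u) module, ('u, 'u) lmod_arr) monoidal_data \<Rightarrow>
     ('u, 'u) module" where
  "RR R T = regular_module R \<and>\<^sub>o\<^bsub>T\<^esub> regular_module R"

definition RR_act1 ::
    "('u, 'z) ring_scheme \<Rightarrow> (('u, 'u) module, ('u, 'u) lmod_arr) monoidal_data \<Rightarrow>
     'u \<Rightarrow> 'u \<Rightarrow> 'u" where
  "RR_act1 R T x r = fn (Id (LMod R) (regular_module R) \<and>\<^sub>a\<^bsub>T\<^esub> right_mult R r) x"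

definition RR_act2 ::
    "('u, 'z) ring_scheme \<Rightarrow> (('u, 'u) module, ('u, 'u) lmod_arr) monoidal_data \<Rightarrow>
     'u \<Rightarrow> 'u \<Rightarrow> 'u" where
  "RR_act2 R T x r = fn (right_mult R r \<and>\<^sub>a\<^bsub>T\<^esub> Id (LMod R) (regular_module R)) x"

end

(* Write rho_a : R -> A for the arrow s |-> s a. The comparison map is
   l (x) a (x) b |-> (rho_a /\ rho_b)(l), and no exactness or free modules are needed to see that
   it is bijective. If F has a right adjoint, arrows F A -> X are arrows A -> Y for the universal
   arrow F Y -> X; reading elements of Y as arrows R -> Y shows that F A has the universal property
   of F R (x) A. Applied to - /\ B and to R /\ - (a left adjoint by the braiding) this says that
   A /\ B is universal among small modules for balanced trilinear maps out of (R /\ R) x A x B,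
   and so is the tensor product, once it is known to be small. *)
theory Submission
  imports Defs
begin

section \<open>Arrows of module categories\<close>

text \<open>The adjoint acts as a dictionary. A family of arrows F R -> X indexed by A is a map from
  A to the elements of Y; additivity of F matches addition of arrows with addition in Y, and rho_(r
  a) = rho_a o rho_r does the same for scalars. So compatible families are linear maps A -> Y, hence
  arrows F A -> X.

  The obstacle is one of size. A \<and> B is universal only against objects of
  \<open>LMod R\<close>, whose carriers are small sets of elements of \<open>'u\<close>, while the
  tensor product consists of cosets of formal sums. It has to be copied into \<open>'u\<close>,
  hence to be counted. The universe may be countable, with the finite sets as its small sets;
  integer combinations of triples are then too many for a crude count, and the relations have to
  absorb the coefficients.\<close>

lemma lmod_hom_closed: "\<lbrakk>f \<in> lmod_hom R M N; x \<in> carrier M\<rbrakk> \<Longrightarrow> f x \<in> carrier N"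
  and lmod_hom_add:
    "\<lbrakk>f \<in> lmod_hom R M N; x \<in> carrier M; y \<in> carrier M\<rbrakk> \<Longrightarrow> f (x \<oplus>\<^bsub>M\<^esub> y) = f x \<oplus>\<^bsub>N\<^esub> f y"
  and lmod_hom_smult:
    "\<lbrakk>f \<in> lmod_hom R M N; r \<in> carrier R; x \<in> carrier M\<rbrakk> \<Longrightarrow> f (r \<odot>\<^bsub>M\<^esub> x) = r \<odot>\<^bsub>N\<^esub> f x"
  by (auto simp: lmod_hom_def)

lemma lmod_hom_comp:
  assumes "f \<in> lmod_hom R L M" "g \<in> lmod_hom R M N"
  shows "(\<lambda>x. g (f x)) \<in> lmod_hom R L N"
  using assms by (auto simp: lmod_hom_def Pi_iff)

lemma lmod_arr_eqI:
  assumes "f \<in> Hom (LMod R) M N" "g \<in> Hom (LMod R) M N"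
    and "\<And>x. x \<in> carrier M \<Longrightarrow> fn f x = fn g x"
  shows "f = g"
proof (rule lmod_arr.expand, intro conjI)
  show "fn f = fn g"
    using assms by (intro extensionalityI[of _ "carrier M"]) (auto simp: in_Hom_LMod)
qed (use assms in \<open>auto simp: in_Hom_LMod\<close>)

lemma fn_Comp:
  assumes "f \<in> Hom (LMod R) A B" "x \<in> carrier A"
  shows "fn (g \<cdot>\<^bsub>LMod R\<^esub> f) x = fn g (fn f x)"
  using assms by (auto simp: in_Hom_LMod) (auto simp: LMod_def compose_def)

lemma fn_Id: "x \<in> carrier A \<Longrightarrow> fn (Id (LMod R) A) x = x"
  by (simp add: LMod_def)

lemma fn_hom: "f \<in> Hom (LMod R) A B \<Longrightarrow> fn f \<in> lmod_hom R A B"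
  by (simp add: in_Hom_LMod)

lemma fn_closed: "\<lbrakk>f \<in> Hom (LMod R) A B; x \<in> carrier A\<rbrakk> \<Longrightarrow> fn f x \<in> carrier B"
  by (rule lmod_hom_closed[OF fn_hom])

lemma fn_arr_add:
  "\<lbrakk>f \<in> Hom (LMod R) A B; x \<in> carrier A\<rbrakk> \<Longrightarrow> fn (arr_add f g) x = fn f x \<oplus>\<^bsub>B\<^esub> fn g x"
  by (auto simp: arr_add_def in_Hom_LMod)

lemma Obj_LMod: "M \<in> Obj (LMod R) \<longleftrightarrow> left_module R M \<and> small (carrier M)"
  by (simp add: LMod_def)

lemma lmod_hom_arr:
  assumes "left_module R M" "f \<in> lmod_hom R M N"
  shows "Arr M (restrict f (carrier M)) N \<in> Hom (LMod R) M N"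
proof -
  interpret left_module R M by fact
  show ?thesis using assms(2) by (auto simp: in_Hom_LMod lmod_hom_def smult_closed)
qed

lemma arr_add_in_Hom:
  assumes N: "left_module R N" and M: "left_module R M"
    and f: "f \<in> Hom (LMod R) M N" and g: "g \<in> Hom (LMod R) M N"
  shows "arr_add f g \<in> Hom (LMod R) M N"
proof -
  interpret N: left_module R N by fact
  interpret M: left_module R M by fact
  note [simp] = fn_closed[OF f] fn_closed[OF g]
  have [simp]: "src f = M" "tgt f = N" using f by (auto simp: in_Hom_LMod)
  have "(\<lambda>x. fn f x \<oplus>\<^bsub>N\<^esub> fn g x) \<in> lmod_hom R M N"
    by (auto simp: lmod_hom_def lmod_hom_add[OF fn_hom[OF f]] lmod_hom_add[OF fn_hom[OF g]]
        lmod_hom_smult[OF fn_hom[OF f]] lmod_hom_smult[OF fn_hom[OF g]]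
        N.smult_r_distr N.M.add.m_ac)
  from lmod_hom_arr[OF M this] show ?thesis by (simp add: arr_add_def)
qed

text \<open>Arrows are linear. With this, additivity of a functor survives composition with its
  universal arrow.\<close>

lemma comp_arr_add:
  assumes "A \<in> Obj (LMod R)" "B \<in> Obj (LMod R)" "D \<in> Obj (LMod R)"
    and f: "f \<in> Hom (LMod R) A B" and g: "g \<in> Hom (LMod R) A B" and h: "h \<in> Hom (LMod R) B D"
  shows "h \<cdot>\<^bsub>LMod R\<^esub> arr_add f g = arr_add (h \<cdot>\<^bsub>LMod R\<^esub> f) (h \<cdot>\<^bsub>LMod R\<^esub> g)"
proof -
  interpret category "LMod R" by (rule LMod_category)
  have m: "left_module R A" "left_module R B" "left_module R D"
    using assms by (auto simp: Obj_LMod)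
  have hf: "h \<cdot>\<^bsub>LMod R\<^esub> f \<in> Hom (LMod R) A D" "h \<cdot>\<^bsub>LMod R\<^esub> g \<in> Hom (LMod R) A D"
    using assms by (auto intro: Comp_in_Hom)
  have fg: "arr_add f g \<in> Hom (LMod R) A B" by (rule arr_add_in_Hom[OF m(2,1) f g])
  show ?thesis
  proof (rule lmod_arr_eqI)
    show "h \<cdot>\<^bsub>LMod R\<^esub> arr_add f g \<in> Hom (LMod R) A D"
      using assms fg by (auto intro: Comp_in_Hom)
    show "arr_add (h \<cdot>\<^bsub>LMod R\<^esub> f) (h \<cdot>\<^bsub>LMod R\<^esub> g) \<in> Hom (LMod R) A D"
      by (rule arr_add_in_Hom[OF m(3,1) hf])
    show "fn (h \<cdot>\<^bsub>LMod R\<^esub> arr_add f g) x = fn (arr_add (h \<cdot>\<^bsub>LMod R\<^esub> f) (h \<cdot>\<^bsub>LMod R\<^esub> g)) x"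
      if "x \<in> carrier A" for x
      using that by (simp add: fn_Comp[OF fg] fn_arr_add[OF f] fn_arr_add[OF hf(1)]
          fn_Comp[OF f] fn_Comp[OF g] lmod_hom_add[OF fn_hom[OF h]] fn_closed[OF f] fn_closed[OF g])
  qed
qed


section \<open>Elements as arrows from the regular module\<close>

text \<open>The arrow rho_a. For the regular module it is right multiplication by \<open>a\<close>,
  so one construction serves both for elements of modules and for the two right structures on R
  \<and> R.\<close>

definition point :: "('u, 'z) ring_scheme \<Rightarrow> ('u, 'u) module \<Rightarrow> 'u \<Rightarrow> ('u, 'u) lmod_arr" where
  "point R M a = Arr (regular_module R) (\<lambda>s\<in>carrier R. s \<odot>\<^bsub>M\<^esub> a) M"

lemma right_mult_eq_point: "right_mult R r = point R (regular_module R) r"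
  by (simp add: right_mult_def point_def) (simp add: regular_module_def)

lemma regular_module_simps [simp]:
  "carrier (regular_module R) = carrier R" "add (regular_module R) = add R"
  "ring.zero (regular_module R) = ring.zero R" "smult (regular_module R) = mult R"
  by (simp_all add: regular_module_def)

locale univ_module = left_module R M
  for R :: "('u, 'z) ring_scheme" (structure) and M :: "('u, 'u) module" (structure)
begin

lemma point_in_Hom: "a \<in> carrier M \<Longrightarrow> point R M a \<in> Hom (LMod R) (regular_module R) M"
  by (auto simp: in_Hom_LMod point_def lmod_hom_def smult_closed smult_l_distr smult_assoc)

lemma fn_point: "s \<in> carrier R \<Longrightarrow> fn (point R M a) s = s \<odot>\<^bsub>M\<^esub> a"
  by (simp add: point_def)

lemma point_add:
  assumes "a \<in> carrier M" "b \<in> carrier M"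
  shows "point R M (a \<oplus>\<^bsub>M\<^esub> b) = arr_add (point R M a) (point R M b)"
proof (rule lmod_arr_eqI)
  show "arr_add (point R M a) (point R M b) \<in> Hom (LMod R) (regular_module R) M"
    using assms by (intro arr_add_in_Hom point_in_Hom left_module_axioms
        regular_module_left_module R.ring_axioms)
  show "fn (point R M (a \<oplus>\<^bsub>M\<^esub> b)) x = fn (arr_add (point R M a) (point R M b)) x"
    if "x \<in> carrier (regular_module R)" for x
    using assms that by (subst fn_arr_add[OF point_in_Hom]) (auto simp: fn_point smult_r_distr)
qed (simp add: assms point_in_Hom)

text \<open>Since \<open>g s = s g(1)\<close>, evaluation at one inverts \<open>point\<close>: the
  elements of \<open>M\<close> are in bijection with the arrows from the regular module to
  it.\<close>

lemma arr_eq_point: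
  assumes "g \<in> Hom (LMod R) (regular_module R) M"
  shows "g = point R M (fn g \<one>)"
proof (rule lmod_arr_eqI[OF assms])
  have 1: "fn g \<one> \<in> carrier M" using fn_closed[OF assms] by simp
  then show "point R M (fn g \<one>) \<in> Hom (LMod R) (regular_module R) M" by (rule point_in_Hom)
  show "fn g x = fn (point R M (fn g \<one>)) x" if "x \<in> carrier (regular_module R)" for x
    using that lmod_hom_smult[OF fn_hom[OF assms], of x \<one>] by (simp add: fn_point)
qed

lemma point_eq_iff:
  assumes "a \<in> carrier M" "b \<in> carrier M"
  shows "point R M a = point R M b \<longleftrightarrow> a = b"
  using assms fn_point[of \<one>] smult_one by (metis R.one_closed)

lemma point_one: "point R (regular_module R) \<one> = Id (LMod R) (regular_module R)"
  by (auto simp: point_def LMod_def fun_eq_iff)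

end

text \<open>From \<open>f (s a) = s (f a)\<close>: the passage from elements to arrows is natural.
  Naturality of the comparison map comes down to this.\<close>

lemma comp_point:
  assumes "left_module R M" "left_module R N" "a \<in> carrier M" and f: "f \<in> Hom (LMod R) M N"
  shows "f \<cdot>\<^bsub>LMod R\<^esub> point R M a = point R N (fn f a)"
proof -
  interpret M: univ_module R M using assms by (simp add: univ_module.intro)
  interpret N: univ_module R N using assms by (simp add: univ_module.intro)
  have "tgt f = N" using f by (simp add: in_Hom_LMod)
  then show ?thesis using lmod_hom_smult[OF fn_hom[OF f]] assms(3)
    by (auto simp: LMod_def point_def compose_def fun_eq_iff)
qed

text \<open>From s (r a) = (s r) a. Scalars acting on \<open>a\<close> become arrows to be composed,
  so a functor carries them over to its value at the regular module.\<close>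

lemma point_smult:
  assumes "left_module R M" "r \<in> carrier R" "a \<in> carrier M"
  shows "point R M (r \<odot>\<^bsub>M\<^esub> a) = point R M a \<cdot>\<^bsub>LMod R\<^esub> right_mult R r"
proof -
  interpret univ_module R M using assms by (simp add: univ_module.intro)
  have "point R M a \<cdot>\<^bsub>LMod R\<^esub> point R (regular_module R) r = point R M (fn (point R M a) r)"
    using assms by (intro comp_point regular_module_left_module R.ring_axioms point_in_Hom) auto
  then show ?thesis using assms by (simp add: right_mult_eq_point fn_point)
qed


section \<open>Additive left adjoints on module categories\<close>

text \<open>A right adjoint reduced to its counit: \<open>Y\<close> with \<epsilon> is terminal
  among the arrows from values of \<open>Fo\<close> to \<open>X\<close>. In this form the property
  passes easily from - \<and> A to A \<and> -, by composing \<epsilon> with the braiding.\<close>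

definition has_universal_arrows ::
    "('o, 'a) category \<Rightarrow> ('o \<Rightarrow> 'o) \<Rightarrow> ('a \<Rightarrow> 'a) \<Rightarrow> bool" where
  "has_universal_arrows C Fo Fa \<longleftrightarrow>
     (\<forall>X\<in>Obj C. \<exists>Y\<in>Obj C. \<exists>\<epsilon>\<in>Hom C (Fo Y) X. \<forall>A\<in>Obj C. \<forall>f\<in>Hom C (Fo A) X.
        \<exists>!g. g \<in> Hom C A Y \<and> \<epsilon> \<cdot>\<^bsub>C\<^esub> Fa g = f)"

text \<open>The universal arrow is the counit, the arrow that \<Phi> sends to the identity of
  \<open>Go X\<close>.\<close>

lemma has_universal_arrowsI:
  assumes "has_right_adjoint C C Fo Fa"
  shows "has_universal_arrows C Fo Fa"
  unfolding has_universal_arrows_def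
proof
  fix X assume X: "X \<in> Obj C"
  obtain Go Ga \<Phi> where "adjunction C C Fo Fa Go Ga \<Phi>"
    using assms by (auto simp: has_right_adjoint_def)
  then interpret adjunction C C Fo Fa Go Ga \<Phi> .
  have GX: "Go X \<in> Obj C" using X by (rule G.Fo_Obj)
  define \<epsilon> where "\<epsilon> = inv_into (Hom C (Fo (Go X)) X) (\<Phi> (Go X) X) (Id C (Go X))"
  have IdG: "Id C (Go X) \<in> \<Phi> (Go X) X ` Hom C (Fo (Go X)) X"
    using \<Phi>_bij[OF GX X] F.C.Id_in_Hom[OF GX] by (simp add: bij_betw_def)
  have \<epsilon>: "\<epsilon> \<in> Hom C (Fo (Go X)) X" and \<Phi>\<epsilon>: "\<Phi> (Go X) X \<epsilon> = Id C (Go X)"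
    unfolding \<epsilon>_def by (rule inv_into_into[OF IdG], rule f_inv_into_f[OF IdG])
  \<comment> \<open>Naturality of \<Phi> at the counit: \<open>\<Phi> A X\<close> recovers
    \<open>g\<close> from its composite with \<epsilon>. This gives uniqueness of \<open>g\<close>;
    injectivity of \<Phi> then gives existence.\<close>
  have key: "\<Phi> A X (\<epsilon> \<cdot>\<^bsub>C\<^esub> Fa g) = g" if A: "A \<in> Obj C" and g: "g \<in> Hom C A (Go X)" for A g
  proof -
    have Fg: "Fa g \<in> Hom C (Fo A) (Fo (Go X))" using A GX g by (rule F.Fa_Hom)
    have eg: "\<epsilon> \<cdot>\<^bsub>C\<^esub> Fa g \<in> Hom C (Fo A) X"
      using Fg \<epsilon> A GX X by (auto intro: F.C.Comp_in_Hom F.Fo_Obj)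
    have "\<Phi> A X (Id C X \<cdot>\<^bsub>C\<^esub> \<epsilon> \<cdot>\<^bsub>C\<^esub> Fa g) = Ga (Id C X) \<cdot>\<^bsub>C\<^esub> \<Phi> (Go X) X \<epsilon> \<cdot>\<^bsub>C\<^esub> g"
      by (rule \<Phi>_natural[OF GX A X X g \<epsilon> F.C.Id_in_Hom[OF X]])
    moreover have "Id C X \<cdot>\<^bsub>C\<^esub> \<epsilon> \<cdot>\<^bsub>C\<^esub> Fa g = \<epsilon> \<cdot>\<^bsub>C\<^esub> Fa g"
      using F.Fo_Obj[OF A] X eg by (rule F.C.Comp_Id_left)
    ultimately show ?thesis
      using A GX g by (simp add: \<Phi>\<epsilon> G.Fa_Id[OF X] F.C.Comp_Id_left)
  qed
  show "\<exists>Y\<in>Obj C. \<exists>\<epsilon>\<in>Hom C (Fo Y) X. \<forall>A\<in>Obj C. \<forall>f\<in>Hom C (Fo A) X.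
        \<exists>!g. g \<in> Hom C A Y \<and> \<epsilon> \<cdot>\<^bsub>C\<^esub> Fa g = f"
  proof (rule bexI[OF _ GX], rule bexI[OF _ \<epsilon>], intro ballI)
    fix A f assume A: "A \<in> Obj C" and f: "f \<in> Hom C (Fo A) X"
    have g: "\<Phi> A X f \<in> Hom C A (Go X)" using \<Phi>_bij[OF A X] f by (auto simp: bij_betw_def)
    have "\<epsilon> \<cdot>\<^bsub>C\<^esub> Fa (\<Phi> A X f) \<in> Hom C (Fo A) X"
      using \<epsilon> A GX X g by (auto intro: F.C.Comp_in_Hom F.Fo_Obj F.Fa_Hom)
    then have "\<epsilon> \<cdot>\<^bsub>C\<^esub> Fa (\<Phi> A X f) = f"
      using key[OF A g] \<Phi>_bij[OF A X] f by (auto simp: bij_betw_def inj_on_def)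
    with g key[OF A] show "\<exists>!g. g \<in> Hom C A (Go X) \<and> \<epsilon> \<cdot>\<^bsub>C\<^esub> Fa g = f"
      by metis
  qed
qed

lemma has_right_adjoint_functor:
  "has_right_adjoint C D Fo Fa \<Longrightarrow> cat_functor C D Fo Fa"
  by (auto simp: has_right_adjoint_def adjunction_def)

text \<open>The universal property of \<open>F R \<otimes> A\<close>, satisfied by \<open>F A\<close>: a family \<open>k a\<close> corresponds
  to a family of arrows \<open>R \<longrightarrow> Y\<close>, that is to a family of elements of \<open>Y\<close>, where
  \<open>\<epsilon> : F Y \<longrightarrow> X\<close> is universal.\<close>

lemma eilenberg_watts:
  fixes R :: "('u, 'z) ring_scheme"
  assumes R: "ring R" "small (carrier R)"
    and F: "cat_functor (LMod R) (LMod R) Fo Fa" "additive_functor R Fa"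
      "has_universal_arrows (LMod R) Fo Fa"
    and A: "A \<in> Obj (LMod R)" and X: "X \<in> Obj (LMod R)"
    and k: "\<And>a. a \<in> carrier A \<Longrightarrow> k a \<in> Hom (LMod R) (Fo (regular_module R)) X"
    and k_add: "\<And>a b. a \<in> carrier A \<Longrightarrow> b \<in> carrier A \<Longrightarrow> k (a \<oplus>\<^bsub>A\<^esub> b) = arr_add (k a) (k b)"
    and k_smult: "\<And>r a. r \<in> carrier R \<Longrightarrow> a \<in> carrier A \<Longrightarrow>
      k (r \<odot>\<^bsub>A\<^esub> a) = k a \<cdot>\<^bsub>LMod R\<^esub> Fa (right_mult R r)"
  shows "\<exists>!h. h \<in> Hom (LMod R) (Fo A) X \<and> (\<forall>a\<in>carrier A. h \<cdot>\<^bsub>LMod R\<^esub> Fa (point R A a) = k a)"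
proof -
  interpret F: cat_functor "LMod R" "LMod R" Fo Fa by fact
  let ?R = "regular_module R"
  have RO: "?R \<in> Obj (LMod R)" using R regular_module_left_module by (simp add: Obj_LMod)
  interpret RM: univ_module R ?R using RO by (simp add: Obj_LMod univ_module.intro)
  interpret A: univ_module R A using A by (simp add: Obj_LMod univ_module.intro)
  obtain Y \<epsilon> where Y: "Y \<in> Obj (LMod R)" and \<epsilon>: "\<epsilon> \<in> Hom (LMod R) (Fo Y) X"
    and "\<forall>B\<in>Obj (LMod R). \<forall>f\<in>Hom (LMod R) (Fo B) X.
        \<exists>!g. g \<in> Hom (LMod R) B Y \<and> \<epsilon> \<cdot>\<^bsub>LMod R\<^esub> Fa g = f"
    using bspec[OF F(3)[unfolded has_universal_arrows_def] X] by blast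
  note univ = this(3)[rule_format]
  interpret Y: univ_module R Y using Y by (simp add: Obj_LMod univ_module.intro)
  have assoc: "\<epsilon> \<cdot>\<^bsub>LMod R\<^esub> Fa (g' \<cdot>\<^bsub>LMod R\<^esub> g) = (\<epsilon> \<cdot>\<^bsub>LMod R\<^esub> Fa g') \<cdot>\<^bsub>LMod R\<^esub> Fa g"
    if "B \<in> Obj (LMod R)" "B' \<in> Obj (LMod R)" "g \<in> Hom (LMod R) B B'" "g' \<in> Hom (LMod R) B' Y"
    for B B' g g'
    using that Y X \<epsilon> by (simp add: F.Fa_Comp[of B B' Y] F.Fo_Obj F.Fa_Hom
        F.C.Comp_assoc[of "Fo B" "Fo B'" "Fo Y" X])
  have in_Hom: "\<epsilon> \<cdot>\<^bsub>LMod R\<^esub> Fa g \<in> Hom (LMod R) (Fo B) X"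
    if "B \<in> Obj (LMod R)" "g \<in> Hom (LMod R) B Y" for B g
    using that Y X \<epsilon> by (auto intro: F.C.Comp_in_Hom F.Fo_Obj F.Fa_Hom)
  have inj: "g = g'" if "B \<in> Obj (LMod R)" "g \<in> Hom (LMod R) B Y" "g' \<in> Hom (LMod R) B Y"
    "\<epsilon> \<cdot>\<^bsub>LMod R\<^esub> Fa g = \<epsilon> \<cdot>\<^bsub>LMod R\<^esub> Fa g'" for B g g'
    using univ[OF that(1) in_Hom[OF that(1,3)]] that by blast
  \<comment> \<open>Universality at the regular module makes \<open>k a\<close> an arrow from it to
    \<open>Y\<close>, and such an arrow is an element of \<open>Y\<close>.\<close>
  have "\<exists>y. y \<in> carrier Y \<and> \<epsilon> \<cdot>\<^bsub>LMod R\<^esub> Fa (point R Y y) = k a" if a: "a \<in> carrier A" for a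
  proof -
    obtain g where g: "g \<in> Hom (LMod R) ?R Y" "\<epsilon> \<cdot>\<^bsub>LMod R\<^esub> Fa g = k a"
      using univ[OF RO k[OF a]] by blast
    then show ?thesis using Y.arr_eq_point[OF g(1)] fn_closed[OF g(1), of "\<one>\<^bsub>R\<^esub>"] by auto
  qed
  then obtain m where m: "\<And>a. a \<in> carrier A \<Longrightarrow> m a \<in> carrier Y"
    and \<epsilon>m: "\<And>a. a \<in> carrier A \<Longrightarrow> \<epsilon> \<cdot>\<^bsub>LMod R\<^esub> Fa (point R Y (m a)) = k a"
    by metis
  \<comment> \<open>Factorizations through \<epsilon> are unique, so the two elements may be
    compared after composition with \<epsilon>; additivity of \<open>Fa\<close> turns the sum of
    elements into a sum of arrows.\<close>
  have m_add: "m (a \<oplus>\<^bsub>A\<^esub> b) = m a \<oplus>\<^bsub>Y\<^esub> m b" if "a \<in> carrier A" "b \<in> carrier A" for a b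
  proof -
    note Fp = F.Fa_Hom[OF RO Y Y.point_in_Hom[OF m]]
    have "\<epsilon> \<cdot>\<^bsub>LMod R\<^esub> Fa (point R Y (m a \<oplus>\<^bsub>Y\<^esub> m b))
        = \<epsilon> \<cdot>\<^bsub>LMod R\<^esub> arr_add (Fa (point R Y (m a))) (Fa (point R Y (m b)))"
      using F(2) that RO Y m by (simp add: Y.point_add additive_functor_def Y.point_in_Hom)
    also have "\<dots> = arr_add (k a) (k b)"
      using comp_arr_add[OF F.Fo_Obj[OF RO] F.Fo_Obj[OF Y] X Fp[OF that(1)] Fp[OF that(2)] \<epsilon>] \<epsilon>m that
      by simp
    also have "\<dots> = \<epsilon> \<cdot>\<^bsub>LMod R\<^esub> Fa (point R Y (m (a \<oplus>\<^bsub>A\<^esub> b)))"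
      using that by (simp add: k_add \<epsilon>m)
    finally show ?thesis
      using inj[OF RO Y.point_in_Hom Y.point_in_Hom] that m by (simp add: Y.point_eq_iff)
  qed
  \<comment> \<open>The scalar moves from \<open>Y\<close> into an endomorphism of the regular
    module, where \<open>Fa\<close> and then \<open>k_smult\<close> apply.\<close>
  have m_smult: "m (r \<odot>\<^bsub>A\<^esub> a) = r \<odot>\<^bsub>Y\<^esub> m a" if "r \<in> carrier R" "a \<in> carrier A" for r a
  proof -
    have "\<epsilon> \<cdot>\<^bsub>LMod R\<^esub> Fa (point R Y (r \<odot>\<^bsub>Y\<^esub> m a))
        = \<epsilon> \<cdot>\<^bsub>LMod R\<^esub> Fa (point R Y (m a) \<cdot>\<^bsub>LMod R\<^esub> right_mult R r)"
      using that m by (simp add: point_smult Y.left_module_axioms)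
    also have "\<dots> = k a \<cdot>\<^bsub>LMod R\<^esub> Fa (right_mult R r)"
      using that m RO by (subst assoc) (auto simp: right_mult_eq_point RM.point_in_Hom Y.point_in_Hom \<epsilon>m)
    also have "\<dots> = \<epsilon> \<cdot>\<^bsub>LMod R\<^esub> Fa (point R Y (m (r \<odot>\<^bsub>A\<^esub> a)))"
      using that by (simp add: k_smult \<epsilon>m A.smult_closed)
    finally show ?thesis
      using inj[OF RO Y.point_in_Hom Y.point_in_Hom] that m
      by (simp add: Y.point_eq_iff A.smult_closed Y.smult_closed)
  qed
  define n where "n = Arr A (restrict m (carrier A)) Y"
  have n: "n \<in> Hom (LMod R) A Y"
    unfolding n_def by (rule lmod_hom_arr)
      (auto simp: lmod_hom_def m m_add m_smult A.left_module_axioms)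
  \<comment> \<open>Restricting along the points of \<open>A\<close> reads off the values of
    \<open>g\<close>; hence the family \<open>k\<close> prescribes exactly the map
    \<open>m\<close>.\<close>
  have comp_k: "(\<epsilon> \<cdot>\<^bsub>LMod R\<^esub> Fa g) \<cdot>\<^bsub>LMod R\<^esub> Fa (point R A a)
      = \<epsilon> \<cdot>\<^bsub>LMod R\<^esub> Fa (point R Y (fn g a))" if "g \<in> Hom (LMod R) A Y" "a \<in> carrier A" for g a
    using that assoc[OF RO A A.point_in_Hom that(1)]
    by (simp add: comp_point[OF A.left_module_axioms Y.left_module_axioms])
  show ?thesis
  proof (intro ex1I conjI ballI)
    show "\<epsilon> \<cdot>\<^bsub>LMod R\<^esub> Fa n \<in> Hom (LMod R) (Fo A) X" by (rule in_Hom[OF A n])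
    show "(\<epsilon> \<cdot>\<^bsub>LMod R\<^esub> Fa n) \<cdot>\<^bsub>LMod R\<^esub> Fa (point R A a) = k a" if "a \<in> carrier A" for a
      using that \<epsilon>m by (simp add: comp_k[OF n]) (simp add: n_def)
  next
    fix h assume h: "h \<in> Hom (LMod R) (Fo A) X \<and>
      (\<forall>a\<in>carrier A. h \<cdot>\<^bsub>LMod R\<^esub> Fa (point R A a) = k a)"
    then obtain g where g: "g \<in> Hom (LMod R) A Y" "h = \<epsilon> \<cdot>\<^bsub>LMod R\<^esub> Fa g" using univ[OF A] by metis
    have "g = n"
    proof (rule lmod_arr_eqI[OF g(1) n])
      fix a assume a: "a \<in> carrier A"
      have "\<epsilon> \<cdot>\<^bsub>LMod R\<^esub> Fa (point R Y (fn g a)) = \<epsilon> \<cdot>\<^bsub>LMod R\<^esub> Fa (point R Y (m a))"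
        using h a g comp_k[OF g(1) a] by (simp add: \<epsilon>m)
      then have "fn g a = m a"
        using inj[OF RO Y.point_in_Hom Y.point_in_Hom] a m fn_closed[OF g(1) a]
        by (simp add: Y.point_eq_iff)
      then show "fn g a = fn n a" using a by (simp add: n_def)
    qed
    then show "h = \<epsilon> \<cdot>\<^bsub>LMod R\<^esub> Fa n" using g by simp
  qed
qed


section \<open>The tensor product of three factors\<close>

definition pure_tensor ::
    "('r, 'z) ring_scheme \<Rightarrow> ('r, 'l) module \<Rightarrow> ('l \<Rightarrow> 'r \<Rightarrow> 'l) \<Rightarrow> ('l \<Rightarrow> 'r \<Rightarrow> 'l) \<Rightarrow>
     ('r, 'a) module \<Rightarrow> ('r, 'b) module \<Rightarrow> 'l \<Rightarrow> 'a \<Rightarrow> 'b \<Rightarrow> (('l \<times> 'a \<times> 'b) \<Rightarrow>\<^sub>0 int) set" where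
  "pure_tensor R \<Lambda> act1 act2 A B l a b =
     tensor3_ker R \<Lambda> act1 act2 A B #>\<^bsub>tensor3_free \<Lambda> A B\<^esub> frag_of (l, a, b)"

locale tensor3_factors = L: twofold_bimodule R \<Lambda> act1 act2 + A: left_module R A + B: left_module R B
  for R :: "('r, 'z) ring_scheme" and \<Lambda> :: "('r, 'l) module" and act1 act2
    and A :: "('r, 'a) module" and B :: "('r, 'b) module"
begin

abbreviation "G \<equiv> tensor3_free \<Lambda> A B"
abbreviation "K \<equiv> tensor3_ker R \<Lambda> act1 act2 A B"
abbreviation "Q \<equiv> tensor3 R \<Lambda> act1 act2 A B"
abbreviation "pure \<equiv> pure_tensor R \<Lambda> act1 act2 A B"

sublocale G: comm_group G
  by (simp add: tensor3_free_def abelian_free_Abelian_group)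

sublocale K: normal K G
  by (rule tensor3_ker_normal) unfold_locales

sublocale Q: left_module R Q
  by (rule tensor3_left_module) unfold_locales

section \<open>Computing with cosets\<close>

lemma frag_of_closed:
  "\<lbrakk>l \<in> carrier \<Lambda>; a \<in> carrier A; b \<in> carrier B\<rbrakk> \<Longrightarrow> frag_of (l, a, b) \<in> carrier G"
  by (simp add: tensor3_free_def)

lemma free_add_closed: "\<lbrakk>x \<in> carrier G; y \<in> carrier G\<rbrakk> \<Longrightarrow> x + y \<in> carrier G"
  using G.m_closed by (simp add: tensor3_free_def)

lemma free_diff_closed: "\<lbrakk>x \<in> carrier G; y \<in> carrier G\<rbrakk> \<Longrightarrow> x - y \<in> carrier G"
  using keys_diff[of x y] by (auto simp: tensor3_free_def)

lemma coset_closed: "x \<in> carrier G \<Longrightarrow> K #>\<^bsub>G\<^esub> x \<in> carrier Q"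
  by (simp add: carrier_tensor3)

lemma coset_add:
  "\<lbrakk>x \<in> carrier G; y \<in> carrier G\<rbrakk> \<Longrightarrow> (K #>\<^bsub>G\<^esub> x) \<oplus>\<^bsub>Q\<^esub> (K #>\<^bsub>G\<^esub> y) = K #>\<^bsub>G\<^esub> (x + y)"
  using K.rcos_sum[of x y] by (simp add: tensor3_def Let_def tensor3_free_def)

lemma coset_diff:
  assumes "x \<in> carrier G" "y \<in> carrier G"
  shows "K #>\<^bsub>G\<^esub> (x - y) = (K #>\<^bsub>G\<^esub> x) \<ominus>\<^bsub>Q\<^esub> (K #>\<^bsub>G\<^esub> y)"
proof -
  have "K #>\<^bsub>G\<^esub> x = (K #>\<^bsub>G\<^esub> (x - y)) \<oplus>\<^bsub>Q\<^esub> (K #>\<^bsub>G\<^esub> y)"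
    using assms coset_add[OF free_diff_closed[OF assms] assms(2)] by simp
  then show ?thesis
    using assms by (simp add: a_minus_def Q.a_assoc coset_closed free_diff_closed Q.r_neg)
qed

lemma coset_zero: "K #>\<^bsub>G\<^esub> 0 = \<zero>\<^bsub>Q\<^esub>"
  using K.rcos_const G.coset_join2[OF _ K.subgroup_axioms K.one_closed]
  by (simp add: tensor3_def Let_def tensor3_free_def)

lemma coset_eqI:
  assumes "x - y \<in> K" "y \<in> carrier G"
  shows "K #>\<^bsub>G\<^esub> x = K #>\<^bsub>G\<^esub> y"
proof -
  have "K #>\<^bsub>G\<^esub> x = (K #>\<^bsub>G\<^esub> (x - y)) \<oplus>\<^bsub>Q\<^esub> (K #>\<^bsub>G\<^esub> y)"
    using assms coset_add[OF K.mem_carrier[OF assms(1)] assms(2)] by simp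
  also have "K #>\<^bsub>G\<^esub> (x - y) = K #>\<^bsub>G\<^esub> \<one>\<^bsub>G\<^esub>"
    using assms K.mem_carrier by (simp add: G.coset_join2 K.subgroup_axioms)
  also have "\<dots> = \<zero>\<^bsub>Q\<^esub>"
    using coset_zero by (simp add: tensor3_free_def)
  finally show ?thesis using assms by (simp add: coset_closed)
qed

section \<open>Pure tensors and their relations\<close>

lemma pure_closed [simp]:
  "\<lbrakk>l \<in> carrier \<Lambda>; a \<in> carrier A; b \<in> carrier B\<rbrakk> \<Longrightarrow> pure l a b \<in> carrier Q"
  by (simp add: pure_tensor_def coset_closed frag_of_closed)

lemma rel_in_ker: "x \<in> tensor3_rels R \<Lambda> act1 act2 A B \<Longrightarrow> x \<in> K"
  unfolding tensor3_ker_def by (rule generate.incl)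

lemma pure_add_left:
  "\<lbrakk>l \<in> carrier \<Lambda>; l' \<in> carrier \<Lambda>; a \<in> carrier A; b \<in> carrier B\<rbrakk> \<Longrightarrow>
    pure (l \<oplus>\<^bsub>\<Lambda>\<^esub> l') a b = pure l a b \<oplus>\<^bsub>Q\<^esub> pure l' a b"
  unfolding pure_tensor_def
  by (subst coset_add) (auto intro!: frag_of_closed free_add_closed coset_eqI rel_in_ker tensor3_rels.intros)

lemma pure_add_middle:
  "\<lbrakk>l \<in> carrier \<Lambda>; a \<in> carrier A; a' \<in> carrier A; b \<in> carrier B\<rbrakk> \<Longrightarrow>
    pure l (a \<oplus>\<^bsub>A\<^esub> a') b = pure l a b \<oplus>\<^bsub>Q\<^esub> pure l a' b"
  unfolding pure_tensor_def
  by (subst coset_add) (auto intro!: frag_of_closed free_add_closed coset_eqI rel_in_ker tensor3_rels.intros)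

lemma pure_add_right:
  "\<lbrakk>l \<in> carrier \<Lambda>; a \<in> carrier A; b \<in> carrier B; b' \<in> carrier B\<rbrakk> \<Longrightarrow>
    pure l a (b \<oplus>\<^bsub>B\<^esub> b') = pure l a b \<oplus>\<^bsub>Q\<^esub> pure l a b'"
  unfolding pure_tensor_def
  by (subst coset_add) (auto intro!: frag_of_closed free_add_closed coset_eqI rel_in_ker tensor3_rels.intros)

lemma pure_act1:
  "\<lbrakk>l \<in> carrier \<Lambda>; r \<in> carrier R; a \<in> carrier A; b \<in> carrier B\<rbrakk> \<Longrightarrow>
    pure (act1 l r) a b = pure l a (r \<odot>\<^bsub>B\<^esub> b)"
  unfolding pure_tensor_def
  by (auto intro!: frag_of_closed coset_eqI rel_in_ker tensor3_rels.intros B.smult_closed)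

lemma pure_act2:
  "\<lbrakk>l \<in> carrier \<Lambda>; r \<in> carrier R; a \<in> carrier A; b \<in> carrier B\<rbrakk> \<Longrightarrow>
    pure (act2 l r) a b = pure l (r \<odot>\<^bsub>A\<^esub> a) b"
  unfolding pure_tensor_def
  by (auto intro!: frag_of_closed coset_eqI rel_in_ker tensor3_rels.intros A.smult_closed)

text \<open>From 0 + 0 = 0. It allows terms with zero coefficient to be inserted into a sum of pure
  tensors.\<close>

lemma pure_zero:
  assumes "a \<in> carrier A" "b \<in> carrier B"
  shows "pure \<zero>\<^bsub>\<Lambda>\<^esub> a b = \<zero>\<^bsub>Q\<^esub>"
  using assms pure_add_left[of "\<zero>\<^bsub>\<Lambda>\<^esub>" "\<zero>\<^bsub>\<Lambda>\<^esub>" a b] by simp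

lemma smult_pure:
  assumes "r \<in> carrier R" "l \<in> carrier \<Lambda>" "a \<in> carrier A" "b \<in> carrier B"
  shows "r \<odot>\<^bsub>Q\<^esub> pure l a b = pure (r \<odot>\<^bsub>\<Lambda>\<^esub> l) a b"
proof -
  note m = L.twofold_bimodule_axioms A.left_module_axioms B.left_module_axioms
  have id: "(\<lambda>a. a) \<in> lmod_hom R M M" for M :: "(_, 'k) module" by (simp add: lmod_hom_def)
  have "tensor3_induced K G (\<lambda>l. r \<odot>\<^bsub>\<Lambda>\<^esub> l) (\<lambda>a. a) (\<lambda>b. b) (pure l a b) = pure (r \<odot>\<^bsub>\<Lambda>\<^esub> l) a b"
    using assms unfolding pure_tensor_def
    by (subst tensor3_induced_coset[OF m m _ _ _ _ id id frag_of_closed])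
      (auto simp: L.one.smult_closed L.one.smult_r_distr L.one.act_smult L.two.act_smult)
  then show ?thesis by (simp add: tensor3_def Let_def)
qed

text \<open>Differences replace sums and negatives because \<open>frag_induction\<close> builds the
  free abelian group in this way; its steps carry over to cosets.\<close>

lemma tensor3_induct [consumes 1, case_names zero pure diff]:
  assumes t: "t \<in> carrier Q" and zero: "P \<zero>\<^bsub>Q\<^esub>"
    and pure: "\<And>l a b. \<lbrakk>l \<in> carrier \<Lambda>; a \<in> carrier A; b \<in> carrier B\<rbrakk> \<Longrightarrow> P (pure l a b)"
    and diff: "\<And>s t. \<lbrakk>s \<in> carrier Q; t \<in> carrier Q; P s; P t\<rbrakk> \<Longrightarrow> P (s \<ominus>\<^bsub>Q\<^esub> t)"
  shows "P t"
proof -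
  obtain x where x: "x \<in> carrier G" and t: "t = K #>\<^bsub>G\<^esub> x" using t by (auto simp: carrier_tensor3)
  \<comment> \<open>Membership in \<open>G\<close> is carried through the induction since
    \<open>coset_diff\<close> asks for it.\<close>
  have "x \<in> carrier G \<and> P (K #>\<^bsub>G\<^esub> x)"
    using x[unfolded tensor3_free_def carrier_free_Abelian_group_iff]
  proof (induction x rule: frag_induction)
    case zero
    then show ?case using \<open>P \<zero>\<^bsub>Q\<^esub>\<close> by (simp add: coset_zero) (simp add: tensor3_free_def)
  next
    case (one x)
    then show ?case using pure by (auto simp: pure_tensor_def frag_of_closed)
  next
    case (diff x y)
    then show ?case using assms(4) by (simp add: coset_diff coset_closed free_diff_closed)
  qed
  then show ?thesis by (simp add: t)
qed

text \<open>Pure tensors generate the quotient as a group. Only additivity is asked, since this also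
  serves to prove that a map on the quotient respects scalars.\<close>

lemma additive_eqI:
  assumes X: "abelian_group X"
    and u: "u \<in> carrier Q \<rightarrow> carrier X"
      "\<And>s t. \<lbrakk>s \<in> carrier Q; t \<in> carrier Q\<rbrakk> \<Longrightarrow> u (s \<oplus>\<^bsub>Q\<^esub> t) = u s \<oplus>\<^bsub>X\<^esub> u t"
    and v: "v \<in> carrier Q \<rightarrow> carrier X"
      "\<And>s t. \<lbrakk>s \<in> carrier Q; t \<in> carrier Q\<rbrakk> \<Longrightarrow> v (s \<oplus>\<^bsub>Q\<^esub> t) = v s \<oplus>\<^bsub>X\<^esub> v t"
    and uv: "\<And>l a b. \<lbrakk>l \<in> carrier \<Lambda>; a \<in> carrier A; b \<in> carrier B\<rbrakk> \<Longrightarrow> u (pure l a b) = v (pure l a b)"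
    and t: "t \<in> carrier Q"
  shows "u t = v t"
proof -
  interpret X: abelian_group X by fact
  have w_zero: "w \<zero>\<^bsub>Q\<^esub> = \<zero>\<^bsub>X\<^esub>" and w_diff: "w s = w (s \<ominus>\<^bsub>Q\<^esub> t) \<oplus>\<^bsub>X\<^esub> w t"
    if "s \<in> carrier Q" "t \<in> carrier Q" "w \<in> carrier Q \<rightarrow> carrier X"
      "\<And>s t. \<lbrakk>s \<in> carrier Q; t \<in> carrier Q\<rbrakk> \<Longrightarrow> w (s \<oplus>\<^bsub>Q\<^esub> t) = w s \<oplus>\<^bsub>X\<^esub> w t" for w s t
  proof -
    have "w \<zero>\<^bsub>Q\<^esub> \<in> carrier X" using that(3) by auto
    then show "w \<zero>\<^bsub>Q\<^esub> = \<zero>\<^bsub>X\<^esub>" using that(4)[of "\<zero>\<^bsub>Q\<^esub>" "\<zero>\<^bsub>Q\<^esub>"] by simp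
    have "w ((s \<ominus>\<^bsub>Q\<^esub> t) \<oplus>\<^bsub>Q\<^esub> t) = w (s \<ominus>\<^bsub>Q\<^esub> t) \<oplus>\<^bsub>X\<^esub> w t"
      using that(1,2) by (intro that(4)) auto
    then show "w s = w (s \<ominus>\<^bsub>Q\<^esub> t) \<oplus>\<^bsub>X\<^esub> w t"
      using that(1,2) by (simp add: a_minus_def Q.a_assoc Q.l_neg)
  qed
  show ?thesis using t
  proof (induction rule: tensor3_induct)
    case zero show ?case using w_zero[OF t t u] w_zero[OF t t v] by simp
  next
    case (diff s t)
    have *: "u (s \<ominus>\<^bsub>Q\<^esub> t) \<in> carrier X" "v (s \<ominus>\<^bsub>Q\<^esub> t) \<in> carrier X" "u t \<in> carrier X"
      using u(1) v(1) diff.hyps Q.minus_closed[OF diff.hyps] by auto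
    have "u (s \<ominus>\<^bsub>Q\<^esub> t) \<oplus>\<^bsub>X\<^esub> u t = v (s \<ominus>\<^bsub>Q\<^esub> t) \<oplus>\<^bsub>X\<^esub> u t"
      using w_diff[OF diff.hyps u] w_diff[OF diff.hyps v] diff.IH by simp
    then show ?case using * by simp
  qed (rule uv)
qed

lemma lmod_hom_eqI:
  assumes "left_module R X" "u \<in> lmod_hom R Q X" "v \<in> lmod_hom R Q X"
    and "\<And>l a b. \<lbrakk>l \<in> carrier \<Lambda>; a \<in> carrier A; b \<in> carrier B\<rbrakk> \<Longrightarrow> u (pure l a b) = v (pure l a b)"
    and "t \<in> carrier Q"
  shows "u t = v t"
  by (rule additive_eqI[where X = X]) (use assms in \<open>auto simp: left_module_def lmod_hom_def\<close>)

text \<open>A map on triples extends to the free abelian group, and each relation is killed by the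
  matching hypothesis. The target may have any carrier type, so no size condition enters on this
  side of the comparison.\<close>

lemma tensor3_universal:
  fixes X :: "('r, 'x) module"
  assumes X: "left_module R X"
    and h: "\<And>l a b. \<lbrakk>l \<in> carrier \<Lambda>; a \<in> carrier A; b \<in> carrier B\<rbrakk> \<Longrightarrow> h l a b \<in> carrier X"
    and add1: "\<And>l l' a b. \<lbrakk>l \<in> carrier \<Lambda>; l' \<in> carrier \<Lambda>; a \<in> carrier A; b \<in> carrier B\<rbrakk> \<Longrightarrow>
      h (l \<oplus>\<^bsub>\<Lambda>\<^esub> l') a b = h l a b \<oplus>\<^bsub>X\<^esub> h l' a b"
    and add2: "\<And>l a a' b. \<lbrakk>l \<in> carrier \<Lambda>; a \<in> carrier A; a' \<in> carrier A; b \<in> carrier B\<rbrakk> \<Longrightarrow>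
      h l (a \<oplus>\<^bsub>A\<^esub> a') b = h l a b \<oplus>\<^bsub>X\<^esub> h l a' b"
    and add3: "\<And>l a b b'. \<lbrakk>l \<in> carrier \<Lambda>; a \<in> carrier A; b \<in> carrier B; b' \<in> carrier B\<rbrakk> \<Longrightarrow>
      h l a (b \<oplus>\<^bsub>B\<^esub> b') = h l a b \<oplus>\<^bsub>X\<^esub> h l a b'"
    and bal1: "\<And>l r a b. \<lbrakk>l \<in> carrier \<Lambda>; r \<in> carrier R; a \<in> carrier A; b \<in> carrier B\<rbrakk> \<Longrightarrow>
      h (act1 l r) a b = h l a (r \<odot>\<^bsub>B\<^esub> b)"
    and bal2: "\<And>l r a b. \<lbrakk>l \<in> carrier \<Lambda>; r \<in> carrier R; a \<in> carrier A; b \<in> carrier B\<rbrakk> \<Longrightarrow>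
      h (act2 l r) a b = h l (r \<odot>\<^bsub>A\<^esub> a) b"
    and smult: "\<And>l r a b. \<lbrakk>l \<in> carrier \<Lambda>; r \<in> carrier R; a \<in> carrier A; b \<in> carrier B\<rbrakk> \<Longrightarrow>
      h (r \<odot>\<^bsub>\<Lambda>\<^esub> l) a b = r \<odot>\<^bsub>X\<^esub> h l a b"
  obtains H where "H \<in> lmod_hom R Q X"
    and "\<And>l a b. \<lbrakk>l \<in> carrier \<Lambda>; a \<in> carrier A; b \<in> carrier B\<rbrakk> \<Longrightarrow> H (pure l a b) = h l a b"
proof -
  interpret X: left_module R X by fact
  let ?h = "\<lambda>(l, a, b). h l a b"
  have "?h ` (carrier \<Lambda> \<times> carrier A \<times> carrier B) \<subseteq> carrier (add_monoid X)"
    using h by auto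
  then obtain h' where h': "h' \<in> hom G (add_monoid X)"
    and h'_of: "\<And>p. p \<in> carrier \<Lambda> \<times> carrier A \<times> carrier B \<Longrightarrow> h' (frag_of p) = ?h p"
    unfolding tensor3_free_def
    by (rule comm_group.free_Abelian_group_universal[OF X.a_comm_group]) blast
  interpret h': group_hom G "add_monoid X" h'
    by (intro group_hom.intro group_hom_axioms.intro h' X.a_group) unfold_locales
  have h'_add: "h' (x + y) = h' x \<oplus>\<^bsub>X\<^esub> h' y" if "x \<in> carrier G" "y \<in> carrier G" for x y
    using h'.hom_mult[OF that] by (simp add: tensor3_free_def)
  have h'_closed: "h' x \<in> carrier X" if "x \<in> carrier G" for x
    using h'.hom_closed[OF that] by simp
  \<comment> \<open>Every relation is a difference, so it is enough that its two terms have the same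
    image.\<close>
  have ker: "h' (x - y) = \<zero>\<^bsub>X\<^esub>" if "x \<in> carrier G" "y \<in> carrier G" "h' x = h' y" for x y
  proof -
    have "h' (x - y) \<oplus>\<^bsub>X\<^esub> h' y = h' y"
      using h'_add[OF free_diff_closed[OF that(1,2)] that(2)] that by simp
    then show ?thesis using that by (simp add: h'_closed free_diff_closed)
  qed
  have "K \<subseteq> kernel G (add_monoid X) h'"
    unfolding tensor3_ker_def
  proof (rule G.generate_subgroup_incl[OF _ h'.subgroup_kernel], rule subsetI)
    fix x assume "x \<in> tensor3_rels R \<Lambda> act1 act2 A B"
    then have "h' x = \<zero>\<^bsub>X\<^esub>"
      by cases
        (auto intro!: ker free_add_closed frag_of_closed
          simp: h'_add h'_of frag_of_closed add1 add2 add3 bal1 bal2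
            L.one.act_closed L.two.act_closed A.smult_closed B.smult_closed)
    moreover have "x \<in> carrier G"
      using K.mem_carrier rel_in_ker \<open>x \<in> tensor3_rels R \<Lambda> act1 act2 A B\<close> by blast
    ultimately show "x \<in> kernel G (add_monoid X) h'" by (simp add: kernel_def)
  qed
  then obtain H where H: "H \<in> hom (G Mod K) (add_monoid X)"
    and H_coset: "\<And>x. x \<in> carrier G \<Longrightarrow> H (K #>\<^bsub>G\<^esub> x) = h' x"
    using h'.FactGroup_universal_kernel[OF K.normal_axioms] by blast
  have H_closed: "H t \<in> carrier X" if "t \<in> carrier Q" for t
    using H that by (auto simp: hom_def tensor3_def Let_def)
  have H_add: "H (s \<oplus>\<^bsub>Q\<^esub> t) = H s \<oplus>\<^bsub>X\<^esub> H t" if "s \<in> carrier Q" "t \<in> carrier Q" for s t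
    using hom_mult[OF H, of s t] that by (simp add: tensor3_def Let_def)
  have H_pure: "H (pure l a b) = h l a b"
    if "l \<in> carrier \<Lambda>" "a \<in> carrier A" "b \<in> carrier B" for l a b
    using that by (simp add: pure_tensor_def H_coset frag_of_closed h'_of)
  \<comment> \<open>Scaling before \<open>H\<close> and scaling after \<open>H\<close> are both
    additive in \<open>t\<close>, so they may be compared on pure tensors.\<close>
  have H_smult: "H (r \<odot>\<^bsub>Q\<^esub> t) = r \<odot>\<^bsub>X\<^esub> H t" if "r \<in> carrier R" "t \<in> carrier Q" for r t
    by (rule additive_eqI[where t = t, OF X.abelian_group_axioms])
      (use that in \<open>auto simp: H_closed H_add H_pure smult_pure smult Q.smult_closed X.smult_closed
         Q.smult_r_distr X.smult_r_distr L.one.smult_closed\<close>)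
  show thesis
    by (rule that[of H]) (auto simp: lmod_hom_def H_closed H_add H_smult H_pure)
qed

text \<open>In the proof \<open>S\<close> is the graph of a function of \<open>(a, b)\<close>: collecting the terms
  with the same \<open>(a, b)\<close> removes the integer coefficients.  So the tensor product has at most
  as many elements as \<open>\<Lambda> \<times> A \<times> B\<close> has subsets, also when small sets are finite.\<close>

lemma tensor3_eq_finsum:
  assumes "t \<in> carrier Q"
  obtains S where "S \<subseteq> carrier \<Lambda> \<times> carrier A \<times> carrier B"
    and "t = finsum Q (\<lambda>(l, a, b). pure l a b) S"
proof -
  let ?C = "carrier A \<times> carrier B"
  let ?f = "\<lambda>c p. pure (c p) (fst p) (snd p)"
  \<comment> \<open>The coefficient function \<open>c\<close> is zero off \<open>D\<close>, so that
    two representations can be written over the union of their supports; the added terms vanish by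
    \<open>pure_zero\<close>.\<close>
  have "\<exists>D c. finite D \<and> D \<subseteq> ?C \<and> c \<in> ?C \<rightarrow> carrier \<Lambda> \<and> (\<forall>p. p \<notin> D \<longrightarrow> c p = \<zero>\<^bsub>\<Lambda>\<^esub>) \<and>
      t = finsum Q (?f c) D"
    using assms
  proof (induction rule: tensor3_induct)
    case zero
    show ?case by (intro exI[of _ "{}"] exI[of _ "\<lambda>_. \<zero>\<^bsub>\<Lambda>\<^esub>"]) simp
  next
    case (pure l a b)
    then show ?case
      by (intro exI[of _ "{(a, b)}"] exI[of _ "\<lambda>p. if p = (a, b) then l else \<zero>\<^bsub>\<Lambda>\<^esub>"])
        auto
  next
    case (diff s t)
    obtain D c where D: "finite D" "D \<subseteq> ?C" and c: "c \<in> ?C \<rightarrow> carrier \<Lambda>"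
      and c0: "\<And>p. p \<notin> D \<Longrightarrow> c p = \<zero>\<^bsub>\<Lambda>\<^esub>" and s: "s = finsum Q (?f c) D"
      using diff.IH(1) by auto
    obtain D' c' where D': "finite D'" "D' \<subseteq> ?C" and c': "c' \<in> ?C \<rightarrow> carrier \<Lambda>"
      and c0': "\<And>p. p \<notin> D' \<Longrightarrow> c' p = \<zero>\<^bsub>\<Lambda>\<^esub>" and t: "t = finsum Q (?f c') D'"
      using diff.IH(2) by auto
    let ?D = "D \<union> D'" and ?c = "\<lambda>p. c p \<ominus>\<^bsub>\<Lambda>\<^esub> c' p"
    have [simp]: "c p \<in> carrier \<Lambda>" "c' p \<in> carrier \<Lambda>" if "p \<in> ?D" for p
      using that D D' c c' by blast+
    have [simp]: "fst p \<in> carrier A" "snd p \<in> carrier B" if "p \<in> ?D" for p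
      using that D D' by auto
    have s': "s = finsum Q (?f c) ?D"
      unfolding s by (rule Q.add.finprod_mono_neutral_cong_left) (use D D' in \<open>auto simp: c0 pure_zero\<close>)
    have t': "t = finsum Q (?f c') ?D"
      unfolding t by (rule Q.add.finprod_mono_neutral_cong_left) (use D D' in \<open>auto simp: c0' pure_zero\<close>)
    \<comment> \<open>Splitting each coefficient as \<open>c = (c - c') + c'\<close> avoids
      negatives of pure tensors.\<close>
    have "s = finsum Q (\<lambda>p. ?f ?c p \<oplus>\<^bsub>Q\<^esub> ?f c' p) ?D"
      unfolding s'
    proof (rule Q.finsum_cong')
      fix p assume p: "p \<in> ?D"
      have "(c p \<ominus>\<^bsub>\<Lambda>\<^esub> c' p) \<oplus>\<^bsub>\<Lambda>\<^esub> c' p = c p"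
        using p by (simp add: a_minus_def L.one.a_assoc L.one.M.l_neg)
      then show "?f c p = ?f ?c p \<oplus>\<^bsub>Q\<^esub> ?f c' p"
        using p pure_add_left[of "?c p" "c' p" "fst p" "snd p"] by simp
    qed auto
    also have "\<dots> = finsum Q (?f ?c) ?D \<oplus>\<^bsub>Q\<^esub> t"
      unfolding t' by (rule Q.finsum_addf) auto
    finally have "s \<ominus>\<^bsub>Q\<^esub> t = finsum Q (?f ?c) ?D"
    proof -
      assume "s = finsum Q (?f ?c) ?D \<oplus>\<^bsub>Q\<^esub> t"
      moreover have "finsum Q (?f ?c) ?D \<in> carrier Q" by (rule Q.finsum_closed) auto
      ultimately show ?thesis using diff.hyps by (simp add: a_minus_def Q.a_assoc Q.r_neg)
    qed
    then show ?case
      using D D' c c' by (intro exI[of _ ?D] exI[of _ ?c]) (auto simp: c0 c0' a_minus_def Pi_iff)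
  qed
  then obtain D c where D: "finite D" "D \<subseteq> ?C" and c: "c \<in> ?C \<rightarrow> carrier \<Lambda>"
    and t: "t = finsum Q (?f c) D" by blast
  \<comment> \<open>Pairing \<open>p\<close> with \<open>c p\<close> is injective, so the sum over
    \<open>D\<close> may be reindexed without merging terms.\<close>
  let ?S = "(\<lambda>p. (c p, fst p, snd p)) ` D"
  show thesis
  proof (rule that[of ?S])
    show "?S \<subseteq> carrier \<Lambda> \<times> carrier A \<times> carrier B" using D c by fastforce
    show "t = finsum Q (\<lambda>(l, a, b). pure l a b) ?S"
      unfolding t by (subst Q.add.finprod_reindex) (use D c in \<open>force simp: inj_on_def Pi_iff\<close>)+
  qed
qed

end

lemma tensor3_map_pure:
  assumes "tensor3_factors R \<Lambda> act1 act2 A B" "tensor3_factors R \<Lambda> act1 act2 A' B'"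
    and f: "f \<in> Hom (LMod R) A A'" and g: "g \<in> Hom (LMod R) B B'"
    and l: "l \<in> carrier \<Lambda>" "a \<in> carrier A" "b \<in> carrier B"
  shows "tensor3_map R \<Lambda> act1 act2 f g (pure_tensor R \<Lambda> act1 act2 A B l a b)
    = pure_tensor R \<Lambda> act1 act2 A' B' l (fn f a) (fn g b)"
proof -
  interpret X: tensor3_factors R \<Lambda> act1 act2 A B by fact
  interpret X': tensor3_factors R \<Lambda> act1 act2 A' B' by fact
  show ?thesis
    using tensor3_map_coset(1)[OF X.L.twofold_bimodule_axioms X.A.left_module_axioms
        X'.A.left_module_axioms X.B.left_module_axioms X'.B.left_module_axioms f g
        X.frag_of_closed[OF l]]
    by (simp add: pure_tensor_def)
qed


section \<open>Small modules\<close>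

text \<open>One of the two factors injects into the other, an infinite set is equipollent to its
  square, and a finite set has a finite square. The product is not of type \<open>'u set\<close>, so
  its size is compared with \<open>UNIV\<close> directly.\<close>

lemma small_Times:
  fixes A B :: "'u set"
  assumes "universe TYPE('u)" "small A" "small B"
  shows "A \<times> B \<prec> (UNIV :: 'u set)"
proof -
  have inf: "infinite (UNIV :: 'u set)" using assms(1) by (simp add: universe_def)
  have square: "M \<times> M \<prec> (UNIV :: 'u set)" if "small M" for M :: "'u set"
  proof (cases "finite M")
    case True
    then show ?thesis using inf by (intro finite_lesspoll_infinite) auto
  next
    case False
    then have "M \<times> M \<approx> M"
      by (simp add: eqpoll_iff_card_of_ordIso card_of_Times_same_infinite)
    then show ?thesis using that unfolding small_def by (rule eq_lesspoll_trans)
  qed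
  have "A \<lesssim> B \<or> B \<lesssim> A"
    unfolding lepoll_def card_of_ordLeq by (rule ordLeq_total[OF card_of_Well_order card_of_Well_order])
  then have "A \<times> B \<lesssim> B \<times> B \<or> A \<times> B \<lesssim> A \<times> A"
    using times_lepoll_mono lepoll_refl by blast
  then show ?thesis using square assms(2,3) lesspoll_trans1 by blast
qed

lemma small_image:
  assumes "S \<prec> (UNIV :: 'u set)"
  shows "small (f ` S :: 'u set)"
  using lesspoll_trans1[OF image_lepoll assms] by (simp add: small_def)

text \<open>The strong limit property in \<open>universe\<close> speaks of sets of elements of
  \<open>'u\<close>; a set \<open>S\<close> of any other type is first copied into
  \<open>'u\<close>.\<close>

lemma Pow_lesspoll_UNIV:
  assumes "universe TYPE('u)" and S: "S \<prec> (UNIV :: 'u set)"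
  shows "Pow S \<prec> (UNIV :: 'u set)"
proof -
  obtain e :: "'a \<Rightarrow> 'u" where e: "inj_on e S" using S by (auto simp: lesspoll_def lepoll_def)
  have "Pow (e ` S) \<prec> (UNIV :: 'u set)"
    using assms(1) small_image[OF S] by (simp add: universe_def)
  moreover have "Pow S \<lesssim> Pow (e ` S)"
    unfolding lepoll_def using inj_on_image_Pow[OF e] by (intro exI[of _ "image e"]) auto
  ultimately show ?thesis by (rule lesspoll_trans1[rotated])
qed

lemma inv_lmod_iso:
  assumes M: "left_module R M" and f: "f \<in> lmod_iso R M N"
  shows "inv_into (carrier M) f \<in> lmod_hom R N M"
proof -
  interpret left_module R M by fact
  have inj: "inj_on f (carrier M)" and N: "carrier N = f ` carrier M"
    using f by (auto simp: lmod_iso_def bij_betw_def)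
  have hom: "f x \<oplus>\<^bsub>N\<^esub> f y = f (x \<oplus>\<^bsub>M\<^esub> y)" "r \<in> carrier R \<Longrightarrow> r \<odot>\<^bsub>N\<^esub> f x = f (r \<odot>\<^bsub>M\<^esub> x)"
    if "x \<in> carrier M" "y \<in> carrier M" for x y r
    using f that by (auto simp: lmod_iso_def lmod_hom_def)
  show ?thesis using inj by (auto simp: lmod_hom_def N hom smult_closed)
qed

text \<open>Transport of structure along a map that is injective on the carrier. In this way the
  tensor product, whose elements are cosets, gets a copy that can be an object of
  \<open>LMod R\<close>.\<close>

definition transport_module :: "('a \<Rightarrow> 'b) \<Rightarrow> ('r, 'a) module \<Rightarrow> ('r, 'b) module" where
  "transport_module \<tau> M =
     (let \<sigma> = inv_into (carrier M) \<tau> in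
      \<lparr>carrier = \<tau> ` carrier M, mult = undefined, one = undefined, ring.zero = \<tau> \<zero>\<^bsub>M\<^esub>,
       add = (\<lambda>x y. \<tau> (\<sigma> x \<oplus>\<^bsub>M\<^esub> \<sigma> y)), smult = (\<lambda>r x. \<tau> (r \<odot>\<^bsub>M\<^esub> \<sigma> x))\<rparr>)"

lemma transport_module:
  assumes M: "left_module R M" and \<tau>: "inj_on \<tau> (carrier M)"
  shows "left_module R (transport_module \<tau> M)" and "\<tau> \<in> lmod_iso R M (transport_module \<tau> M)"
proof -
  interpret left_module R M by fact
  let ?N = "transport_module \<tau> M"
  have [simp]: "carrier ?N = \<tau> ` carrier M" "\<zero>\<^bsub>?N\<^esub> = \<tau> \<zero>\<^bsub>M\<^esub>"
    by (simp_all add: transport_module_def Let_def)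
  have [simp]: "\<tau> x \<oplus>\<^bsub>?N\<^esub> \<tau> y = \<tau> (x \<oplus>\<^bsub>M\<^esub> y)" if "x \<in> carrier M" "y \<in> carrier M" for x y
    using that \<tau> by (simp add: transport_module_def Let_def)
  have [simp]: "r \<odot>\<^bsub>?N\<^esub> \<tau> x = \<tau> (r \<odot>\<^bsub>M\<^esub> x)" if "x \<in> carrier M" for r x
    using that \<tau> by (simp add: transport_module_def Let_def)
  have "\<exists>y\<in>carrier M. \<tau> (x \<oplus>\<^bsub>M\<^esub> y) = \<tau> \<zero>\<^bsub>M\<^esub>" if "x \<in> carrier M" for x
    using M.r_neg[OF that] that by (metis M.a_inv_closed)
  then have "abelian_group ?N"
    by (intro abelian_groupI) (auto simp: M.a_ac)
  then show "left_module R ?N"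
    by (intro left_module.intro left_module_axioms.intro R.ring_axioms)
      (auto simp: smult_closed smult_l_distr smult_r_distr smult_assoc smult_one)
  show "\<tau> \<in> lmod_iso R M ?N"
    using \<tau> by (auto simp: lmod_iso_def lmod_hom_def bij_betw_def smult_closed)
qed

lemma small_tensor3:
  fixes R :: "('u, 'z) ring_scheme" and \<Lambda> A B :: "('u, 'u) module"
  assumes U: "universe TYPE('u)" and L: "twofold_bimodule R \<Lambda> act1 act2"
    and s: "small (carrier \<Lambda>)" and A: "A \<in> Obj (LMod R)" and B: "B \<in> Obj (LMod R)"
  shows "carrier (tensor3 R \<Lambda> act1 act2 A B) \<prec> (UNIV :: 'u set)"
proof -
  interpret tensor3_factors R \<Lambda> act1 act2 A B
    using A B by (intro tensor3_factors.intro L) (auto simp: Obj_LMod)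
  let ?S = "carrier \<Lambda> \<times> carrier A \<times> carrier B"
  have sAB: "small (carrier A)" "small (carrier B)" using A B by (auto simp: Obj_LMod)
  have AB: "carrier A \<times> carrier B \<prec> (UNIV :: 'u set)" by (rule small_Times[OF U sAB])
  \<comment> \<open>\<open>small_Times\<close> takes sets of elements of \<open>'u\<close>, so the
    product of \<open>A\<close> and \<open>B\<close> is copied into \<open>'u\<close> before the
    third factor is added.\<close>
  then obtain e :: "'u \<times> 'u \<Rightarrow> 'u" where e: "inj_on e (carrier A \<times> carrier B)"
    by (auto simp: lesspoll_def lepoll_def)
  have "carrier \<Lambda> \<times> e ` (carrier A \<times> carrier B) \<prec> (UNIV :: 'u set)"
    by (rule small_Times[OF U s small_image[OF AB]])
  moreover have "?S \<approx> carrier \<Lambda> \<times> e ` (carrier A \<times> carrier B)"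
    by (intro times_eqpoll_cong eqpoll_refl) (simp add: e inj_on_image_eqpoll_self eqpoll_sym)
  ultimately have "?S \<prec> (UNIV :: 'u set)" by (rule eq_lesspoll_trans[rotated])
  then have "Pow ?S \<prec> (UNIV :: 'u set)" by (rule Pow_lesspoll_UNIV[OF U])
  \<comment> \<open>Sums over subsets cover the whole tensor product. Only this inclusion matters,
    so the values of \<open>finsum\<close> at the remaining subsets do no harm.\<close>
  moreover have "carrier Q \<subseteq> (\<lambda>S. finsum Q (\<lambda>(l, a, b). pure l a b) S) ` Pow ?S"
    using tensor3_eq_finsum by blast
  then have "carrier Q \<lesssim> Pow ?S" by (meson subset_imp_lepoll image_lepoll lepoll_trans)
  ultimately show ?thesis by (rule lesspoll_trans1[rotated])
qed


section \<open>Additive closed symmetric monoidal structures\<close>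

text \<open>What - \<and> B and A \<and> - have in common; the universal property is derived once
  and applied to both.\<close>

locale additive_left_adjoint = cat_functor "LMod R" "LMod R" Fo Fa
  for R :: "('u, 'z) ring_scheme" and Fo Fa +
  assumes ring: "ring R" and small_ring: "small (carrier R)"
    and additive: "additive_functor R Fa"
    and universal_arrows: "has_universal_arrows (LMod R) Fo Fa"
begin

lemma regular_Obj: "regular_module R \<in> Obj (LMod R)"
  using ring small_ring regular_module_left_module by (simp add: Obj_LMod)

lemma map_point_in_Hom:
  assumes "A \<in> Obj (LMod R)" "a \<in> carrier A"
  shows "Fa (point R A a) \<in> Hom (LMod R) (Fo (regular_module R)) (Fo A)"
  using assms by (intro Fa_Hom regular_Obj univ_module.point_in_Hom) (auto simp: Obj_LMod univ_module.intro)

text \<open>Existence in the universal property of F R \<otimes> A, in terms of elements: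
  \<open>h l a\<close> is the prescribed value on the tensor of \<open>l\<close> and
  \<open>a\<close>, and linearity in \<open>l\<close> makes it a family of arrows to which
  \<open>eilenberg_watts\<close> applies.\<close>

lemma extension_exists:
  assumes A: "A \<in> Obj (LMod R)" and X: "X \<in> Obj (LMod R)"
    and hom: "\<And>a. a \<in> carrier A \<Longrightarrow> (\<lambda>l. h l a) \<in> lmod_hom R (Fo (regular_module R)) X"
    and add: "\<And>l a b. \<lbrakk>l \<in> carrier (Fo (regular_module R)); a \<in> carrier A; b \<in> carrier A\<rbrakk> \<Longrightarrow>
      h l (a \<oplus>\<^bsub>A\<^esub> b) = h l a \<oplus>\<^bsub>X\<^esub> h l b"
    and smult: "\<And>l r a. \<lbrakk>l \<in> carrier (Fo (regular_module R)); r \<in> carrier R; a \<in> carrier A\<rbrakk> \<Longrightarrow>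
      h l (r \<odot>\<^bsub>A\<^esub> a) = h (fn (Fa (right_mult R r)) l) a"
  shows "\<exists>k\<in>Hom (LMod R) (Fo A) X. \<forall>a\<in>carrier A. \<forall>l\<in>carrier (Fo (regular_module R)).
    fn k (fn (Fa (point R A a)) l) = h l a"
proof -
  let ?F = "Fo (regular_module R)"
  interpret RM: univ_module R "regular_module R"
    using regular_Obj by (simp add: Obj_LMod univ_module.intro)
  interpret A: univ_module R A using A by (simp add: Obj_LMod univ_module.intro)
  have F: "?F \<in> Obj (LMod R)" by (rule Fo_Obj[OF regular_Obj])
  define k where "k a = Arr ?F (\<lambda>l\<in>carrier ?F. h l a) X" for a
  have k: "k a \<in> Hom (LMod R) ?F X" if "a \<in> carrier A" for a
    unfolding k_def using F hom[OF that] by (intro lmod_hom_arr) (auto simp: Obj_LMod)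
  have fn_k: "fn (k a) l = h l a" if "l \<in> carrier ?F" for a l
    using that by (simp add: k_def)
  have "\<exists>!h. h \<in> Hom (LMod R) (Fo A) X \<and> (\<forall>a\<in>carrier A. h \<cdot>\<^bsub>LMod R\<^esub> Fa (point R A a) = k a)"
  proof (rule eilenberg_watts[OF ring small_ring cat_functor_axioms additive universal_arrows A X k])
    fix a b assume ab: "a \<in> carrier A" "b \<in> carrier A"
    then show "k (a \<oplus>\<^bsub>A\<^esub> b) = arr_add (k a) (k b)"
      by (auto simp: k_def arr_add_def add fun_eq_iff)
  next
    fix r a assume ra: "r \<in> carrier R" "a \<in> carrier A"
    have rm: "Fa (right_mult R r) \<in> Hom (LMod R) ?F ?F"
      using map_point_in_Hom[OF regular_Obj] ra by (simp add: right_mult_eq_point)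
    show "k (r \<odot>\<^bsub>A\<^esub> a) = k a \<cdot>\<^bsub>LMod R\<^esub> Fa (right_mult R r)"
    proof (rule lmod_arr_eqI)
      show "k (r \<odot>\<^bsub>A\<^esub> a) \<in> Hom (LMod R) ?F X" using ra by (simp add: k A.smult_closed)
      show "k a \<cdot>\<^bsub>LMod R\<^esub> Fa (right_mult R r) \<in> Hom (LMod R) ?F X"
        using F F X rm k[OF ra(2)] by (rule C.Comp_in_Hom)
      show "fn (k (r \<odot>\<^bsub>A\<^esub> a)) l = fn (k a \<cdot>\<^bsub>LMod R\<^esub> Fa (right_mult R r)) l" if "l \<in> carrier ?F" for l
        using that ra by (simp add: fn_Comp[OF rm] fn_k fn_closed[OF rm] smult)
    qed
  qed
  then obtain e where e: "e \<in> Hom (LMod R) (Fo A) X"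
    and ek: "\<And>a. a \<in> carrier A \<Longrightarrow> e \<cdot>\<^bsub>LMod R\<^esub> Fa (point R A a) = k a" by blast
  show ?thesis
  proof (intro bexI[OF _ e] ballI)
    fix a l assume a: "a \<in> carrier A" and l: "l \<in> carrier ?F"
    show "fn e (fn (Fa (point R A a)) l) = h l a"
      using fn_Comp[OF map_point_in_Hom[OF A a] l, of e] by (simp add: ek a fn_k l)
  qed
qed

text \<open>Both arrows solve the extension problem of \<open>eilenberg_watts\<close> for the family
  of composites of \<open>k\<close> with \<open>Fa (point R A a)\<close>, whose additivity and
  balance come from the functor itself.\<close>

lemma extension_unique:
  assumes A: "A \<in> Obj (LMod R)" and X: "X \<in> Obj (LMod R)"
    and k: "k \<in> Hom (LMod R) (Fo A) X" and k': "k' \<in> Hom (LMod R) (Fo A) X"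
    and eq: "\<And>a l. \<lbrakk>a \<in> carrier A; l \<in> carrier (Fo (regular_module R))\<rbrakk> \<Longrightarrow>
      fn k (fn (Fa (point R A a)) l) = fn k' (fn (Fa (point R A a)) l)"
  shows "k = k'"
proof -
  let ?F = "Fo (regular_module R)"
  interpret A: univ_module R A using A by (simp add: Obj_LMod univ_module.intro)
  interpret X: left_module R X using X by (simp add: Obj_LMod)
  have F: "?F \<in> Obj (LMod R)" "Fo A \<in> Obj (LMod R)" using regular_Obj A by (auto intro: Fo_Obj)
  have c: "j \<cdot>\<^bsub>LMod R\<^esub> Fa (point R A a) \<in> Hom (LMod R) ?F X"
    if "a \<in> carrier A" "j \<in> Hom (LMod R) (Fo A) X" for a j
    using F X map_point_in_Hom[OF A that(1)] that(2) by (rule C.Comp_in_Hom)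
  have k'_eq: "k' \<cdot>\<^bsub>LMod R\<^esub> Fa (point R A a) = k \<cdot>\<^bsub>LMod R\<^esub> Fa (point R A a)" if "a \<in> carrier A" for a
    by (rule lmod_arr_eqI[OF c[OF that k'] c[OF that k]])
      (simp add: fn_Comp[OF map_point_in_Hom[OF A that]] eq that)
  have "\<exists>!h. h \<in> Hom (LMod R) (Fo A) X \<and> (\<forall>a\<in>carrier A. h \<cdot>\<^bsub>LMod R\<^esub> Fa (point R A a)
      = k \<cdot>\<^bsub>LMod R\<^esub> Fa (point R A a))"
  proof (rule eilenberg_watts[OF ring small_ring cat_functor_axioms additive universal_arrows A X c[OF _ k]])
    fix a b assume ab: "a \<in> carrier A" "b \<in> carrier A"
    note P = A.point_in_Hom[OF ab(1)] A.point_in_Hom[OF ab(2)]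
    have "Fa (point R A (a \<oplus>\<^bsub>A\<^esub> b)) = arr_add (Fa (point R A a)) (Fa (point R A b))"
      using additive ab P A regular_Obj by (simp add: A.point_add additive_functor_def)
    then show "k \<cdot>\<^bsub>LMod R\<^esub> Fa (point R A (a \<oplus>\<^bsub>A\<^esub> b))
      = arr_add (k \<cdot>\<^bsub>LMod R\<^esub> Fa (point R A a)) (k \<cdot>\<^bsub>LMod R\<^esub> Fa (point R A b))"
      using comp_arr_add[OF F X map_point_in_Hom[OF A ab(1)] map_point_in_Hom[OF A ab(2)] k] by simp
  next
    fix r a assume ra: "r \<in> carrier R" "a \<in> carrier A"
    have rm: "right_mult R r \<in> Hom (LMod R) (regular_module R) (regular_module R)"
      unfolding right_mult_eq_point using regular_Obj ra
      by (intro univ_module.point_in_Hom) (auto simp: Obj_LMod univ_module.intro)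
    show "k \<cdot>\<^bsub>LMod R\<^esub> Fa (point R A (r \<odot>\<^bsub>A\<^esub> a))
      = (k \<cdot>\<^bsub>LMod R\<^esub> Fa (point R A a)) \<cdot>\<^bsub>LMod R\<^esub> Fa (right_mult R r)"
      by (simp add: point_smult[OF A.left_module_axioms ra]
          Fa_Comp[OF regular_Obj regular_Obj A rm A.point_in_Hom[OF ra(2)]]
          C.Comp_assoc[OF F(1) F(1) F(2) X Fa_Hom[OF regular_Obj regular_Obj rm]
            map_point_in_Hom[OF A ra(2)] k])
  qed
  then show ?thesis using k k' k'_eq by blast
qed

end

locale additive_closed_monoidal = closed_symmetric_monoidal "LMod R" T
  for R :: "('u, 'z) ring_scheme" and T +
  assumes ring: "ring R" and small_ring: "small (carrier R)"
    and additive: "additive_tensor R T"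
begin

abbreviation "RM \<equiv> regular_module R"
abbreviation "pt \<equiv> point R"

section \<open>Left adjoints in each variable\<close>

lemma left_tensor:
  assumes "B \<in> Obj (LMod R)"
  shows "additive_left_adjoint R (\<lambda>A. A \<and>\<^sub>o\<^bsub>T\<^esub> B) (\<lambda>f. f \<and>\<^sub>a\<^bsub>T\<^esub> Id (LMod R) B)"
  using additive assms has_right_adjoint_functor[OF closed[OF assms]]
    has_universal_arrowsI[OF closed[OF assms]]
  by (intro additive_left_adjoint.intro additive_left_adjoint_axioms.intro ring small_ring)
    (auto simp: additive_tensor_def)

lemma braiding_Hom:
  "\<lbrakk>A \<in> Obj (LMod R); B \<in> Obj (LMod R)\<rbrakk> \<Longrightarrow>
    braiding T A B \<in> Hom (LMod R) (A \<and>\<^sub>o\<^bsub>T\<^esub> B) (B \<and>\<^sub>o\<^bsub>T\<^esub> A)"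
  using braiding_iso by (auto simp: isomorphisms_def)

lemma right_tensor_functor:
  assumes A: "A \<in> Obj (LMod R)"
  shows "cat_functor (LMod R) (LMod R) (\<lambda>B. A \<and>\<^sub>o\<^bsub>T\<^esub> B) (\<lambda>f. Id (LMod R) A \<and>\<^sub>a\<^bsub>T\<^esub> f)"
proof (intro cat_functor.intro cat_functor_axioms.intro category_axioms)
  fix B B' E f g
  assume "B \<in> Obj (LMod R)" "B' \<in> Obj (LMod R)" "E \<in> Obj (LMod R)"
    "f \<in> Hom (LMod R) B B'" "g \<in> Hom (LMod R) B' E"
  then show "Id (LMod R) A \<and>\<^sub>a\<^bsub>T\<^esub> (g \<cdot>\<^bsub>LMod R\<^esub> f)
      = (Id (LMod R) A \<and>\<^sub>a\<^bsub>T\<^esub> g) \<cdot>\<^bsub>LMod R\<^esub> (Id (LMod R) A \<and>\<^sub>a\<^bsub>T\<^esub> f)"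
    using tensor_Comp[OF A A A _ _ _ Id_in_Hom[OF A] Id_in_Hom[OF A], of B B' E f g] A
    by (simp add: Comp_Id_left[OF A A Id_in_Hom[OF A]])
qed (use A in \<open>auto simp: tensor_obj tensor_Id intro: tensor_arr Id_in_Hom\<close>)

text \<open>Closedness gives an adjoint for - \<and> A. The braiding identifies this functor with A
  \<and> -, and universal arrows are carried along.\<close>

lemma right_tensor:
  assumes A: "A \<in> Obj (LMod R)"
  shows "additive_left_adjoint R (\<lambda>B. A \<and>\<^sub>o\<^bsub>T\<^esub> B) (\<lambda>f. Id (LMod R) A \<and>\<^sub>a\<^bsub>T\<^esub> f)"
proof (intro additive_left_adjoint.intro additive_left_adjoint_axioms.intro ring small_ring
    right_tensor_functor[OF A])
  show "additive_functor R (\<lambda>f. Id (LMod R) A \<and>\<^sub>a\<^bsub>T\<^esub> f)"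
    using additive A by (simp add: additive_tensor_def)
  show "has_universal_arrows (LMod R) (\<lambda>B. A \<and>\<^sub>o\<^bsub>T\<^esub> B) (\<lambda>f. Id (LMod R) A \<and>\<^sub>a\<^bsub>T\<^esub> f)"
    unfolding has_universal_arrows_def
  proof
    fix X assume X: "X \<in> Obj (LMod R)"
    obtain Y \<epsilon> where Y: "Y \<in> Obj (LMod R)" and \<epsilon>: "\<epsilon> \<in> Hom (LMod R) (Y \<and>\<^sub>o\<^bsub>T\<^esub> A) X"
      and "\<forall>B\<in>Obj (LMod R). \<forall>f\<in>Hom (LMod R) (B \<and>\<^sub>o\<^bsub>T\<^esub> A) X.
          \<exists>!g. g \<in> Hom (LMod R) B Y \<and> \<epsilon> \<cdot>\<^bsub>LMod R\<^esub> (g \<and>\<^sub>a\<^bsub>T\<^esub> Id (LMod R) A) = f"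
      using bspec[OF has_universal_arrowsI[OF closed[OF A], unfolded has_universal_arrows_def] X]
      by blast
    note univ = this(3)[rule_format]
    have \<epsilon>': "\<epsilon> \<cdot>\<^bsub>LMod R\<^esub> braiding T A Y \<in> Hom (LMod R) (A \<and>\<^sub>o\<^bsub>T\<^esub> Y) X"
      using tensor_obj[OF A Y] tensor_obj[OF Y A] X braiding_Hom[OF A Y] \<epsilon> by (rule Comp_in_Hom)
    show "\<exists>Y\<in>Obj (LMod R). \<exists>\<epsilon>\<in>Hom (LMod R) (A \<and>\<^sub>o\<^bsub>T\<^esub> Y) X. \<forall>B\<in>Obj (LMod R).
        \<forall>f\<in>Hom (LMod R) (A \<and>\<^sub>o\<^bsub>T\<^esub> B) X.
          \<exists>!g. g \<in> Hom (LMod R) B Y \<and> \<epsilon> \<cdot>\<^bsub>LMod R\<^esub> (Id (LMod R) A \<and>\<^sub>a\<^bsub>T\<^esub> g) = f"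
    proof (rule bexI[OF _ Y], rule bexI[OF _ \<epsilon>'], intro ballI)
      fix B f assume B: "B \<in> Obj (LMod R)" and f: "f \<in> Hom (LMod R) (A \<and>\<^sub>o\<^bsub>T\<^esub> B) X"
      note AB = tensor_obj[OF A B] and BA = tensor_obj[OF B A]
        and AY = tensor_obj[OF A Y] and YA = tensor_obj[OF Y A]
      note bAB = braiding_Hom[OF A B] and bBA = braiding_Hom[OF B A]
      have fb: "f \<cdot>\<^bsub>LMod R\<^esub> braiding T B A \<in> Hom (LMod R) (B \<and>\<^sub>o\<^bsub>T\<^esub> A) X"
        using BA AB X bBA f by (rule Comp_in_Hom)
      \<comment> \<open>Naturality of the braiding exchanges the two factors of g \<and> 1, and
        symmetry makes the braiding invertible; so the factorization problem for \<open>f\<close> is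
        the solved one for \<open>f\<close> composed with the braiding.\<close>
      have iff: "(\<epsilon> \<cdot>\<^bsub>LMod R\<^esub> braiding T A Y) \<cdot>\<^bsub>LMod R\<^esub> (Id (LMod R) A \<and>\<^sub>a\<^bsub>T\<^esub> g) = f
          \<longleftrightarrow> \<epsilon> \<cdot>\<^bsub>LMod R\<^esub> (g \<and>\<^sub>a\<^bsub>T\<^esub> Id (LMod R) A) = f \<cdot>\<^bsub>LMod R\<^esub> braiding T B A"
        (is "?l = f \<longleftrightarrow> ?r = _") if g: "g \<in> Hom (LMod R) B Y" for g
      proof -
        note gI = tensor_arr[OF B Y A A g Id_in_Hom[OF A]]
        note Ig = tensor_arr[OF A A B Y Id_in_Hom[OF A] g]
        have r: "?r \<in> Hom (LMod R) (B \<and>\<^sub>o\<^bsub>T\<^esub> A) X" using BA YA X gI \<epsilon> by (rule Comp_in_Hom)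
        have "?l = \<epsilon> \<cdot>\<^bsub>LMod R\<^esub> braiding T A Y \<cdot>\<^bsub>LMod R\<^esub> (Id (LMod R) A \<and>\<^sub>a\<^bsub>T\<^esub> g)"
          by (rule Comp_assoc[OF AB AY YA X Ig braiding_Hom[OF A Y] \<epsilon>])
        also have "\<dots> = \<epsilon> \<cdot>\<^bsub>LMod R\<^esub> (g \<and>\<^sub>a\<^bsub>T\<^esub> Id (LMod R) A) \<cdot>\<^bsub>LMod R\<^esub> braiding T A B"
          by (simp add: braiding_natural[OF A A B Y Id_in_Hom[OF A] g])
        also have "\<dots> = ?r \<cdot>\<^bsub>LMod R\<^esub> braiding T A B"
          by (rule Comp_assoc[OF AB BA YA X bAB gI \<epsilon>, symmetric])
        finally have l: "?l = ?r \<cdot>\<^bsub>LMod R\<^esub> braiding T A B" .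
        have "(?r \<cdot>\<^bsub>LMod R\<^esub> braiding T A B) \<cdot>\<^bsub>LMod R\<^esub> braiding T B A = ?r"
          using Comp_assoc[OF BA AB BA X bBA bAB r] symmetry[OF B A] Comp_Id_right[OF BA X r] by simp
        moreover have "(f \<cdot>\<^bsub>LMod R\<^esub> braiding T B A) \<cdot>\<^bsub>LMod R\<^esub> braiding T A B = f"
          using Comp_assoc[OF AB BA AB X bAB bBA f] symmetry[OF A B] Comp_Id_right[OF AB X f] by simp
        ultimately show ?thesis unfolding l by metis
      qed
      show "\<exists>!g. g \<in> Hom (LMod R) B Y \<and>
          (\<epsilon> \<cdot>\<^bsub>LMod R\<^esub> braiding T A Y) \<cdot>\<^bsub>LMod R\<^esub> (Id (LMod R) A \<and>\<^sub>a\<^bsub>T\<^esub> g) = f"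
        using univ[OF B fb] iff by (simp cong: conj_cong)
    qed
  qed
qed

lemma RM_Obj: "RM \<in> Obj (LMod R)"
  using ring small_ring regular_module_left_module by (simp add: Obj_LMod)

lemma RR_Obj: "RR R T \<in> Obj (LMod R)"
  unfolding RR_def by (intro tensor_obj RM_Obj)

lemma pt_Hom: "\<lbrakk>A \<in> Obj (LMod R); a \<in> carrier A\<rbrakk> \<Longrightarrow> pt A a \<in> Hom (LMod R) RM A"
  by (intro univ_module.point_in_Hom) (auto simp: Obj_LMod univ_module.intro)

lemma right_mult_Hom: "r \<in> carrier R \<Longrightarrow> right_mult R r \<in> Hom (LMod R) RM RM"
  using pt_Hom[OF RM_Obj] by (simp add: right_mult_eq_point)

lemma fn_tensor_Comp:
  assumes "A \<in> Obj (LMod R)" "A' \<in> Obj (LMod R)" "A'' \<in> Obj (LMod R)"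
    "B \<in> Obj (LMod R)" "B' \<in> Obj (LMod R)" "B'' \<in> Obj (LMod R)"
    "f \<in> Hom (LMod R) A A'" "f' \<in> Hom (LMod R) A' A''"
    "g \<in> Hom (LMod R) B B'" "g' \<in> Hom (LMod R) B' B''" "x \<in> carrier (A \<and>\<^sub>o\<^bsub>T\<^esub> B)"
  shows "fn (f' \<and>\<^sub>a\<^bsub>T\<^esub> g') (fn (f \<and>\<^sub>a\<^bsub>T\<^esub> g) x) = fn ((f' \<cdot>\<^bsub>LMod R\<^esub> f) \<and>\<^sub>a\<^bsub>T\<^esub> (g' \<cdot>\<^bsub>LMod R\<^esub> g)) x"
  using tensor_Comp[OF assms(1-10)] fn_Comp[OF tensor_arr[OF assms(1,2,4,5,7,9)] assms(11)]
  by simp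

text \<open>Bifunctoriality: f \<and> g splits into its two variables in either order. This lets
  universal properties be used one variable at a time, and it makes the two right structures
  commute.\<close>

lemma fn_tensor_left_right:
  assumes "A \<in> Obj (LMod R)" "A' \<in> Obj (LMod R)" "B \<in> Obj (LMod R)" "B' \<in> Obj (LMod R)"
    "f \<in> Hom (LMod R) A A'" "g \<in> Hom (LMod R) B B'" "x \<in> carrier (A \<and>\<^sub>o\<^bsub>T\<^esub> B)"
  shows "fn (f \<and>\<^sub>a\<^bsub>T\<^esub> Id (LMod R) B') (fn (Id (LMod R) A \<and>\<^sub>a\<^bsub>T\<^esub> g) x) = fn (f \<and>\<^sub>a\<^bsub>T\<^esub> g) x"
    and "fn (Id (LMod R) A' \<and>\<^sub>a\<^bsub>T\<^esub> g) (fn (f \<and>\<^sub>a\<^bsub>T\<^esub> Id (LMod R) B) x) = fn (f \<and>\<^sub>a\<^bsub>T\<^esub> g) x"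
  using assms
  by (simp_all add: fn_tensor_Comp[of A A A' B B' B'] fn_tensor_Comp[of A A' A' B B B'] Id_in_Hom
      Comp_Id_left[of A A' f] Comp_Id_left[of B B' g] Comp_Id_right[of A A' f] Comp_Id_right[of B B' g])

text \<open>Associativity, unit and commutation are bifunctoriality, additivity in the scalar is
  additivity of \<and>, and the rest is linearity of arrows.\<close>

lemma twofold_RR: "twofold_bimodule R (RR R T) (RR_act1 R T) (RR_act2 R T)"
proof -
  let ?I = "Id (LMod R) RM"
  note [simp] = RM_Obj Id_in_Hom[OF RM_Obj] right_mult_Hom
  interpret RM: univ_module R RM using RM_Obj by (simp add: Obj_LMod univ_module.intro)
  have RR: "left_module R (RR R T)" using RR_Obj by (simp add: Obj_LMod)
  have 1: "?I \<and>\<^sub>a\<^bsub>T\<^esub> right_mult R r \<in> Hom (LMod R) (RR R T) (RR R T)" if "r \<in> carrier R" for r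
    unfolding RR_def using that by (intro tensor_arr) auto
  have 2: "right_mult R r \<and>\<^sub>a\<^bsub>T\<^esub> ?I \<in> Hom (LMod R) (RR R T) (RR R T)" if "r \<in> carrier R" for r
    unfolding RR_def using that by (intro tensor_arr) auto
  have add: "right_mult R (r \<oplus>\<^bsub>R\<^esub> s) = arr_add (right_mult R r) (right_mult R s)"
    if "r \<in> carrier R" "s \<in> carrier R" for r s
    using that RM.point_add[of r s] by (simp add: right_mult_eq_point)
  \<comment> \<open>The order is reversed: rho_(r s) is rho_r followed by rho_s. Hence these are
    right actions.\<close>
  have mult: "right_mult R (r \<otimes>\<^bsub>R\<^esub> s) = right_mult R s \<cdot>\<^bsub>LMod R\<^esub> right_mult R r"
    if "r \<in> carrier R" "s \<in> carrier R" for r s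
    using that point_smult[OF RM.left_module_axioms, of r s] by (simp add: right_mult_eq_point)
  have one: "right_mult R \<one>\<^bsub>R\<^esub> = ?I" by (simp add: right_mult_eq_point RM.point_one)
  have II: "?I \<cdot>\<^bsub>LMod R\<^esub> ?I = ?I" by (rule Comp_Id_left[OF RM_Obj RM_Obj]) simp
  have Fadd: "?I \<and>\<^sub>a\<^bsub>T\<^esub> arr_add f g = arr_add (?I \<and>\<^sub>a\<^bsub>T\<^esub> f) (?I \<and>\<^sub>a\<^bsub>T\<^esub> g)"
    "arr_add f g \<and>\<^sub>a\<^bsub>T\<^esub> ?I = arr_add (f \<and>\<^sub>a\<^bsub>T\<^esub> ?I) (g \<and>\<^sub>a\<^bsub>T\<^esub> ?I)"
    if "f \<in> Hom (LMod R) RM RM" "g \<in> Hom (LMod R) RM RM" for f g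
    using additive that RM_Obj unfolding additive_tensor_def additive_functor_def by blast+
  have Comp1: "fn (?I \<and>\<^sub>a\<^bsub>T\<^esub> g) (fn (?I \<and>\<^sub>a\<^bsub>T\<^esub> f) l) = fn (?I \<and>\<^sub>a\<^bsub>T\<^esub> (g \<cdot>\<^bsub>LMod R\<^esub> f)) l"
    and Comp2: "fn (g \<and>\<^sub>a\<^bsub>T\<^esub> ?I) (fn (f \<and>\<^sub>a\<^bsub>T\<^esub> ?I) l) = fn ((g \<cdot>\<^bsub>LMod R\<^esub> f) \<and>\<^sub>a\<^bsub>T\<^esub> ?I) l"
    if "f \<in> Hom (LMod R) RM RM" "g \<in> Hom (LMod R) RM RM" "l \<in> carrier (RR R T)" for f g l
    using that by (simp_all add: RR_def fn_tensor_Comp[of RM RM RM RM RM RM] II)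
  have tI: "fn (?I \<and>\<^sub>a\<^bsub>T\<^esub> ?I) l = l" if "l \<in> carrier (RR R T)" for l
    using that by (simp add: tensor_Id fn_Id RR_def)
  show ?thesis
  proof (intro twofold_bimodule.intro right_action.intro right_action_axioms.intro
      twofold_bimodule_axioms.intro RR)
    fix l r s assume *: "l \<in> carrier (RR R T)" "r \<in> carrier R" "s \<in> carrier R"
    show "RR_act2 R T (RR_act1 R T l r) s = RR_act1 R T (RR_act2 R T l s) r"
      using * by (simp add: RR_act1_def RR_act2_def RR_def fn_tensor_left_right[of RM RM RM RM])
  qed (simp_all add: RR_act1_def RR_act2_def fn_closed[OF 1] fn_closed[OF 2]
      lmod_hom_add[OF fn_hom[OF 1]] lmod_hom_add[OF fn_hom[OF 2]]
      lmod_hom_smult[OF fn_hom[OF 1]] lmod_hom_smult[OF fn_hom[OF 2]]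
      add Fadd fn_arr_add[OF 1] fn_arr_add[OF 2] mult Comp1 Comp2 one tI)
qed

text \<open>Uniqueness for - \<and> B reduces the claim to composites with rho_a \<and> 1, which are
  arrows out of R \<and> B; uniqueness for R \<and> - reduces those to rho_a \<and> rho_b.\<close>

lemma tensor_ext:
  assumes A: "A \<in> Obj (LMod R)" and B: "B \<in> Obj (LMod R)" and X: "X \<in> Obj (LMod R)"
    and k: "k \<in> Hom (LMod R) (A \<and>\<^sub>o\<^bsub>T\<^esub> B) X" and k': "k' \<in> Hom (LMod R) (A \<and>\<^sub>o\<^bsub>T\<^esub> B) X"
    and eq: "\<And>l a b. \<lbrakk>l \<in> carrier (RR R T); a \<in> carrier A; b \<in> carrier B\<rbrakk> \<Longrightarrow>
      fn k (fn (pt A a \<and>\<^sub>a\<^bsub>T\<^esub> pt B b) l) = fn k' (fn (pt A a \<and>\<^sub>a\<^bsub>T\<^esub> pt B b) l)"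
  shows "k = k'"
proof -
  interpret FB: additive_left_adjoint R "\<lambda>A. A \<and>\<^sub>o\<^bsub>T\<^esub> B" "\<lambda>f. f \<and>\<^sub>a\<^bsub>T\<^esub> Id (LMod R) B"
    by (rule left_tensor[OF B])
  interpret FR: additive_left_adjoint R "\<lambda>B. RM \<and>\<^sub>o\<^bsub>T\<^esub> B" "\<lambda>f. Id (LMod R) RM \<and>\<^sub>a\<^bsub>T\<^esub> f"
    by (rule right_tensor[OF RM_Obj])
  note RB = tensor_obj[OF RM_Obj B] and AB = tensor_obj[OF A B]
  show ?thesis
  proof (rule FB.extension_unique[OF A X k k'])
    fix a l assume a: "a \<in> carrier A" and l: "l \<in> carrier (RM \<and>\<^sub>o\<^bsub>T\<^esub> B)"
    let ?p = "pt A a \<and>\<^sub>a\<^bsub>T\<^esub> Id (LMod R) B"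
    note p = FB.map_point_in_Hom[OF A a]
    have "k \<cdot>\<^bsub>LMod R\<^esub> ?p = k' \<cdot>\<^bsub>LMod R\<^esub> ?p"
    proof (rule FR.extension_unique[OF B X Comp_in_Hom[OF RB AB X p k] Comp_in_Hom[OF RB AB X p k']])
      fix b l assume b: "b \<in> carrier B" and l: "l \<in> carrier (RM \<and>\<^sub>o\<^bsub>T\<^esub> RM)"
      have "fn (Id (LMod R) RM \<and>\<^sub>a\<^bsub>T\<^esub> pt B b) l \<in> carrier (RM \<and>\<^sub>o\<^bsub>T\<^esub> B)"
        using FR.map_point_in_Hom[OF B b] l by (rule fn_closed)
      then show "fn (k \<cdot>\<^bsub>LMod R\<^esub> ?p) (fn (Id (LMod R) RM \<and>\<^sub>a\<^bsub>T\<^esub> pt B b) l)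
          = fn (k' \<cdot>\<^bsub>LMod R\<^esub> ?p) (fn (Id (LMod R) RM \<and>\<^sub>a\<^bsub>T\<^esub> pt B b) l)"
        using eq[OF _ a b, of l] l
        by (simp add: fn_Comp[OF p] RR_def
            fn_tensor_left_right(1)[OF RM_Obj A RM_Obj B pt_Hom[OF A a] pt_Hom[OF B b] l])
    qed
    then show "fn k (fn ?p l) = fn k' (fn ?p l)"
      using fn_Comp[OF p l, of k] fn_Comp[OF p l, of k'] by simp
  qed
qed

text \<open>Extension goes one variable at a time: over \<open>B\<close> for fixed \<open>a\<close>,
  which gives an arrow \<open>m a\<close> out of R \<and> B, and then over \<open>A\<close>. The
  second extension needs \<open>m\<close> to be additive and balanced, and both are checked with the
  uniqueness part for R \<and> -.\<close>

lemma tensor_universal: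
  assumes A: "A \<in> Obj (LMod R)" and B: "B \<in> Obj (LMod R)" and X: "X \<in> Obj (LMod R)"
    and hom: "\<And>a b. \<lbrakk>a \<in> carrier A; b \<in> carrier B\<rbrakk> \<Longrightarrow> (\<lambda>l. h l a b) \<in> lmod_hom R (RR R T) X"
    and add2: "\<And>l a a' b. \<lbrakk>l \<in> carrier (RR R T); a \<in> carrier A; a' \<in> carrier A; b \<in> carrier B\<rbrakk> \<Longrightarrow>
      h l (a \<oplus>\<^bsub>A\<^esub> a') b = h l a b \<oplus>\<^bsub>X\<^esub> h l a' b"
    and add3: "\<And>l a b b'. \<lbrakk>l \<in> carrier (RR R T); a \<in> carrier A; b \<in> carrier B; b' \<in> carrier B\<rbrakk> \<Longrightarrow>
      h l a (b \<oplus>\<^bsub>B\<^esub> b') = h l a b \<oplus>\<^bsub>X\<^esub> h l a b'"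
    and bal1: "\<And>l r a b. \<lbrakk>l \<in> carrier (RR R T); r \<in> carrier R; a \<in> carrier A; b \<in> carrier B\<rbrakk> \<Longrightarrow>
      h (RR_act1 R T l r) a b = h l a (r \<odot>\<^bsub>B\<^esub> b)"
    and bal2: "\<And>l r a b. \<lbrakk>l \<in> carrier (RR R T); r \<in> carrier R; a \<in> carrier A; b \<in> carrier B\<rbrakk> \<Longrightarrow>
      h (RR_act2 R T l r) a b = h l (r \<odot>\<^bsub>A\<^esub> a) b"
  shows "\<exists>k\<in>Hom (LMod R) (A \<and>\<^sub>o\<^bsub>T\<^esub> B) X. \<forall>l\<in>carrier (RR R T). \<forall>a\<in>carrier A. \<forall>b\<in>carrier B.
    fn k (fn (pt A a \<and>\<^sub>a\<^bsub>T\<^esub> pt B b) l) = h l a b"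
proof -
  interpret A: left_module R A using A by (simp add: Obj_LMod)
  interpret X: left_module R X using X by (simp add: Obj_LMod)
  interpret FB: additive_left_adjoint R "\<lambda>A. A \<and>\<^sub>o\<^bsub>T\<^esub> B" "\<lambda>f. f \<and>\<^sub>a\<^bsub>T\<^esub> Id (LMod R) B"
    by (rule left_tensor[OF B])
  interpret FR: additive_left_adjoint R "\<lambda>B. RM \<and>\<^sub>o\<^bsub>T\<^esub> B" "\<lambda>f. Id (LMod R) RM \<and>\<^sub>a\<^bsub>T\<^esub> f"
    by (rule right_tensor[OF RM_Obj])
  interpret L: twofold_bimodule R "RR R T" "RR_act1 R T" "RR_act2 R T" by (rule twofold_RR)
  let ?p = "\<lambda>b. Id (LMod R) RM \<and>\<^sub>a\<^bsub>T\<^esub> pt B b"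
  note RB = tensor_obj[OF RM_Obj B]
  then have mRB: "left_module R (RM \<and>\<^sub>o\<^bsub>T\<^esub> B)" by (simp add: Obj_LMod)
  have p: "fn (?p b) l \<in> carrier (RM \<and>\<^sub>o\<^bsub>T\<^esub> B)" if "b \<in> carrier B" "l \<in> carrier (RR R T)" for b l
    using FR.map_point_in_Hom[OF B that(1)] that(2)[unfolded RR_def] by (rule fn_closed)
  have "\<exists>k\<in>Hom (LMod R) (RM \<and>\<^sub>o\<^bsub>T\<^esub> B) X. \<forall>b\<in>carrier B. \<forall>l\<in>carrier (RR R T). fn k (fn (?p b) l) = h l a b"
    if a: "a \<in> carrier A" for a
    unfolding RR_def
    by (rule FR.extension_exists[OF B X])
      (use a hom add3 bal1 in \<open>auto simp: RR_def RR_act1_def\<close>)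
  then obtain m where m: "\<And>a. a \<in> carrier A \<Longrightarrow> m a \<in> Hom (LMod R) (RM \<and>\<^sub>o\<^bsub>T\<^esub> B) X"
    and mh: "\<And>a b l. \<lbrakk>a \<in> carrier A; b \<in> carrier B; l \<in> carrier (RR R T)\<rbrakk> \<Longrightarrow>
      fn (m a) (fn (?p b) l) = h l a b"
    by metis
  have m_add: "m (a \<oplus>\<^bsub>A\<^esub> a') = arr_add (m a) (m a')" if a: "a \<in> carrier A" "a' \<in> carrier A" for a a'
    by (rule FR.extension_unique[OF B X m arr_add_in_Hom[OF X.left_module_axioms mRB m m]])
      (use a in \<open>auto simp flip: RR_def simp: p mh add2 fn_arr_add[OF m[OF a(1)]]\<close>)
  \<comment> \<open>Right multiplication in the first factor commutes with rho_b in the second, so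
    it reaches \<open>l\<close> as \<open>RR_act2\<close>, and \<open>bal2\<close> moves the scalar
    to \<open>a\<close>.\<close>
  have m_smult: "m (r \<odot>\<^bsub>A\<^esub> a) = m a \<cdot>\<^bsub>LMod R\<^esub> (right_mult R r \<and>\<^sub>a\<^bsub>T\<^esub> Id (LMod R) B)"
    if r: "r \<in> carrier R" and a: "a \<in> carrier A" for r a
  proof -
    have q: "right_mult R r \<and>\<^sub>a\<^bsub>T\<^esub> Id (LMod R) B \<in> Hom (LMod R) (RM \<and>\<^sub>o\<^bsub>T\<^esub> B) (RM \<and>\<^sub>o\<^bsub>T\<^esub> B)"
      by (intro tensor_arr RM_Obj B right_mult_Hom r Id_in_Hom)
    show ?thesis
    proof (rule FR.extension_unique[OF B X m Comp_in_Hom[OF RB RB X q m]])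
      fix b l assume b: "b \<in> carrier B" and l: "l \<in> carrier (RM \<and>\<^sub>o\<^bsub>T\<^esub> RM)"
      have l': "l \<in> carrier (RR R T)" using l by (simp add: RR_def)
      have "fn (m a \<cdot>\<^bsub>LMod R\<^esub> (right_mult R r \<and>\<^sub>a\<^bsub>T\<^esub> Id (LMod R) B)) (fn (?p b) l)
          = fn (m a) (fn (?p b) (RR_act2 R T l r))"
        using fn_tensor_left_right[OF RM_Obj RM_Obj RM_Obj B right_mult_Hom[OF r] pt_Hom[OF B b] l]
        by (simp add: fn_Comp[OF q p[OF b l']] RR_act2_def)
      then show "fn (m (r \<odot>\<^bsub>A\<^esub> a)) (fn (?p b) l)
          = fn (m a \<cdot>\<^bsub>LMod R\<^esub> (right_mult R r \<and>\<^sub>a\<^bsub>T\<^esub> Id (LMod R) B)) (fn (?p b) l)"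
        using a b r l' by (simp add: mh A.smult_closed L.two.act_closed bal2)
    qed (use r a in \<open>auto simp: A.smult_closed\<close>)
  qed
  have "\<exists>k\<in>Hom (LMod R) (A \<and>\<^sub>o\<^bsub>T\<^esub> B) X. \<forall>a\<in>carrier A. \<forall>l\<in>carrier (RM \<and>\<^sub>o\<^bsub>T\<^esub> B).
      fn k (fn (pt A a \<and>\<^sub>a\<^bsub>T\<^esub> Id (LMod R) B) l) = fn (m a) l"
  proof (rule FB.extension_exists[OF A X])
    fix l r a assume l: "l \<in> carrier (RM \<and>\<^sub>o\<^bsub>T\<^esub> B)" and ra: "r \<in> carrier R" "a \<in> carrier A"
    have q: "right_mult R r \<and>\<^sub>a\<^bsub>T\<^esub> Id (LMod R) B \<in> Hom (LMod R) (RM \<and>\<^sub>o\<^bsub>T\<^esub> B) (RM \<and>\<^sub>o\<^bsub>T\<^esub> B)"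
      by (intro tensor_arr RM_Obj B right_mult_Hom ra Id_in_Hom)
    show "fn (m (r \<odot>\<^bsub>A\<^esub> a)) l = fn (m a) (fn (right_mult R r \<and>\<^sub>a\<^bsub>T\<^esub> Id (LMod R) B) l)"
      using l by (simp add: m_smult[OF ra] fn_Comp[OF q])
  qed (auto simp: fn_hom[OF m] m_add fn_arr_add[OF m])
  then obtain k where k: "k \<in> Hom (LMod R) (A \<and>\<^sub>o\<^bsub>T\<^esub> B) X"
    and km: "\<And>a l. \<lbrakk>a \<in> carrier A; l \<in> carrier (RM \<and>\<^sub>o\<^bsub>T\<^esub> B)\<rbrakk> \<Longrightarrow>
      fn k (fn (pt A a \<and>\<^sub>a\<^bsub>T\<^esub> Id (LMod R) B) l) = fn (m a) l" by blast
  show ?thesis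
  proof (intro bexI[OF _ k] ballI)
    fix l a b assume *: "l \<in> carrier (RR R T)" "a \<in> carrier A" "b \<in> carrier B"
    show "fn k (fn (pt A a \<and>\<^sub>a\<^bsub>T\<^esub> pt B b) l) = h l a b"
      using km[OF *(2) p[OF *(3,1)]] mh[OF *(2,3,1)]
        fn_tensor_left_right(1)[OF RM_Obj A RM_Obj B pt_Hom[OF A *(2)] pt_Hom[OF B *(3)] *(1)[unfolded RR_def]]
      by simp
  qed
qed

text \<open>These relations make the comparison map well defined. For additivity the other factor is
  split off as 1 \<and> rho_b or rho_a \<and> 1, which leaves an additive functor of one variable;
  balance is rho_(r a) = rho_a o rho_r under \<and>.\<close>

lemma tensor_pt_balanced:
  assumes A: "A \<in> Obj (LMod R)" and B: "B \<in> Obj (LMod R)"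
    and l: "l \<in> carrier (RR R T)" and a: "a \<in> carrier A" and b: "b \<in> carrier B"
  shows "a' \<in> carrier A \<Longrightarrow> fn (pt A (a \<oplus>\<^bsub>A\<^esub> a') \<and>\<^sub>a\<^bsub>T\<^esub> pt B b) l
      = fn (pt A a \<and>\<^sub>a\<^bsub>T\<^esub> pt B b) l \<oplus>\<^bsub>A \<and>\<^sub>o\<^bsub>T\<^esub> B\<^esub> fn (pt A a' \<and>\<^sub>a\<^bsub>T\<^esub> pt B b) l"
    and "b' \<in> carrier B \<Longrightarrow> fn (pt A a \<and>\<^sub>a\<^bsub>T\<^esub> pt B (b \<oplus>\<^bsub>B\<^esub> b')) l
      = fn (pt A a \<and>\<^sub>a\<^bsub>T\<^esub> pt B b) l \<oplus>\<^bsub>A \<and>\<^sub>o\<^bsub>T\<^esub> B\<^esub> fn (pt A a \<and>\<^sub>a\<^bsub>T\<^esub> pt B b') l"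
    and "r \<in> carrier R \<Longrightarrow> fn (pt A a \<and>\<^sub>a\<^bsub>T\<^esub> pt B b) (RR_act1 R T l r)
      = fn (pt A a \<and>\<^sub>a\<^bsub>T\<^esub> pt B (r \<odot>\<^bsub>B\<^esub> b)) l"
    and "r \<in> carrier R \<Longrightarrow> fn (pt A a \<and>\<^sub>a\<^bsub>T\<^esub> pt B b) (RR_act2 R T l r)
      = fn (pt A (r \<odot>\<^bsub>A\<^esub> a) \<and>\<^sub>a\<^bsub>T\<^esub> pt B b) l"
proof -
  interpret A: univ_module R A using A by (simp add: Obj_LMod univ_module.intro)
  interpret B: univ_module R B using B by (simp add: Obj_LMod univ_module.intro)
  interpret FA: additive_left_adjoint R "\<lambda>B. A \<and>\<^sub>o\<^bsub>T\<^esub> B" "\<lambda>f. Id (LMod R) A \<and>\<^sub>a\<^bsub>T\<^esub> f"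
    by (rule right_tensor[OF A])
  interpret FB: additive_left_adjoint R "\<lambda>A. A \<and>\<^sub>o\<^bsub>T\<^esub> B" "\<lambda>f. f \<and>\<^sub>a\<^bsub>T\<^esub> Id (LMod R) B"
    by (rule left_tensor[OF B])
  have l': "l \<in> carrier (RM \<and>\<^sub>o\<^bsub>T\<^esub> RM)" using l by (simp add: RR_def)
  note I = Id_in_Hom[OF RM_Obj]
  note pa = pt_Hom[OF A] and pb = pt_Hom[OF B]
  note lr = fn_tensor_left_right[OF RM_Obj A RM_Obj B pa pb l', symmetric]
  have y: "fn (Id (LMod R) RM \<and>\<^sub>a\<^bsub>T\<^esub> pt B b) l \<in> carrier (RM \<and>\<^sub>o\<^bsub>T\<^esub> B)"
    using tensor_arr[OF RM_Obj RM_Obj RM_Obj B I pb[OF b]] l' by (rule fn_closed)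
  have x: "fn (pt A a \<and>\<^sub>a\<^bsub>T\<^esub> Id (LMod R) RM) l \<in> carrier (A \<and>\<^sub>o\<^bsub>T\<^esub> RM)"
    using tensor_arr[OF RM_Obj A RM_Obj RM_Obj pa[OF a] I] l' by (rule fn_closed)
  show "fn (pt A (a \<oplus>\<^bsub>A\<^esub> a') \<and>\<^sub>a\<^bsub>T\<^esub> pt B b) l
      = fn (pt A a \<and>\<^sub>a\<^bsub>T\<^esub> pt B b) l \<oplus>\<^bsub>A \<and>\<^sub>o\<^bsub>T\<^esub> B\<^esub> fn (pt A a' \<and>\<^sub>a\<^bsub>T\<^esub> pt B b) l"
    if a': "a' \<in> carrier A"
  proof -
    have "pt A (a \<oplus>\<^bsub>A\<^esub> a') \<and>\<^sub>a\<^bsub>T\<^esub> Id (LMod R) B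
        = arr_add (pt A a \<and>\<^sub>a\<^bsub>T\<^esub> Id (LMod R) B) (pt A a' \<and>\<^sub>a\<^bsub>T\<^esub> Id (LMod R) B)"
      using FB.additive RM_Obj A a a' pa by (simp add: A.point_add additive_functor_def)
    then show ?thesis
      using a a' b y fn_arr_add[OF FB.map_point_in_Hom[OF A a] y] by (simp add: lr(1))
  qed
  show "fn (pt A a \<and>\<^sub>a\<^bsub>T\<^esub> pt B (b \<oplus>\<^bsub>B\<^esub> b')) l
      = fn (pt A a \<and>\<^sub>a\<^bsub>T\<^esub> pt B b) l \<oplus>\<^bsub>A \<and>\<^sub>o\<^bsub>T\<^esub> B\<^esub> fn (pt A a \<and>\<^sub>a\<^bsub>T\<^esub> pt B b') l"
    if b': "b' \<in> carrier B"
  proof -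
    have "Id (LMod R) A \<and>\<^sub>a\<^bsub>T\<^esub> pt B (b \<oplus>\<^bsub>B\<^esub> b')
        = arr_add (Id (LMod R) A \<and>\<^sub>a\<^bsub>T\<^esub> pt B b) (Id (LMod R) A \<and>\<^sub>a\<^bsub>T\<^esub> pt B b')"
      using FA.additive RM_Obj B b b' pb by (simp add: B.point_add additive_functor_def)
    then show ?thesis
      using a b b' x fn_arr_add[OF FA.map_point_in_Hom[OF B b] x] by (simp add: lr(2))
  qed
  show "fn (pt A a \<and>\<^sub>a\<^bsub>T\<^esub> pt B b) (RR_act1 R T l r) = fn (pt A a \<and>\<^sub>a\<^bsub>T\<^esub> pt B (r \<odot>\<^bsub>B\<^esub> b)) l"
    if r: "r \<in> carrier R"
    unfolding RR_act1_def point_smult[OF B.left_module_axioms r b]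
    by (subst fn_tensor_Comp[OF RM_Obj RM_Obj A RM_Obj RM_Obj B I pa[OF a] right_mult_Hom[OF r] pb[OF b] l'])
      (simp add: Comp_Id_right[OF RM_Obj A pa[OF a]])
  show "fn (pt A a \<and>\<^sub>a\<^bsub>T\<^esub> pt B b) (RR_act2 R T l r) = fn (pt A (r \<odot>\<^bsub>A\<^esub> a) \<and>\<^sub>a\<^bsub>T\<^esub> pt B b) l"
    if r: "r \<in> carrier R"
    unfolding RR_act2_def point_smult[OF A.left_module_axioms r a]
    by (subst fn_tensor_Comp[OF RM_Obj RM_Obj A RM_Obj RM_Obj B right_mult_Hom[OF r] pa[OF a] I pb[OF b] l'])
      (simp add: Comp_Id_right[OF RM_Obj B pb[OF b]])
qed

section \<open>The comparison map\<close>

abbreviation "triple \<equiv> tensor3 R (RR R T) (RR_act1 R T) (RR_act2 R T)"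
abbreviation "pure_triple \<equiv> pure_tensor R (RR R T) (RR_act1 R T) (RR_act2 R T)"

lemma factors:
  "\<lbrakk>A \<in> Obj (LMod R); B \<in> Obj (LMod R)\<rbrakk> \<Longrightarrow>
    tensor3_factors R (RR R T) (RR_act1 R T) (RR_act2 R T) A B"
  by (intro tensor3_factors.intro twofold_RR) (auto simp: Obj_LMod)

lemma comparison_exists:
  assumes A: "A \<in> Obj (LMod R)" and B: "B \<in> Obj (LMod R)"
  shows "\<exists>\<phi>\<in>lmod_hom R (triple A B) (A \<and>\<^sub>o\<^bsub>T\<^esub> B). \<forall>l\<in>carrier (RR R T). \<forall>a\<in>carrier A. \<forall>b\<in>carrier B.
    \<phi> (pure_triple A B l a b) = fn (pt A a \<and>\<^sub>a\<^bsub>T\<^esub> pt B b) l"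
proof -
  interpret tensor3_factors R "RR R T" "RR_act1 R T" "RR_act2 R T" A B by (rule factors[OF A B])
  have h: "pt A a \<and>\<^sub>a\<^bsub>T\<^esub> pt B b \<in> Hom (LMod R) (RR R T) (A \<and>\<^sub>o\<^bsub>T\<^esub> B)"
    if "a \<in> carrier A" "b \<in> carrier B" for a b
    unfolding RR_def using that by (intro tensor_arr RM_Obj A B pt_Hom)
  have m: "left_module R (A \<and>\<^sub>o\<^bsub>T\<^esub> B)" using tensor_obj[OF A B] by (simp add: Obj_LMod)
  show ?thesis
    by (rule tensor3_universal[OF m, where h = "\<lambda>l a b. fn (pt A a \<and>\<^sub>a\<^bsub>T\<^esub> pt B b) l"])
      (auto simp: fn_closed[OF h] lmod_hom_add[OF fn_hom[OF h]] lmod_hom_smult[OF fn_hom[OF h]]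
        tensor_pt_balanced[OF A B])
qed

text \<open>Two universal objects are isomorphic, but A \<and> B can be tested only against objects
  of \<open>LMod R\<close>. So its arrow \<open>k\<close> goes to a copy \<open>N\<close> of the
  tensor product: \<phi> followed by \<open>k\<close> is the injective \<tau>, and the way back
  followed by \<phi> is the identity by \<open>tensor_ext\<close>.\<close>

lemma comparison_iso:
  assumes U: "universe TYPE('u)" and A: "A \<in> Obj (LMod R)" and B: "B \<in> Obj (LMod R)"
    and \<phi>: "\<phi> \<in> lmod_hom R (triple A B) (A \<and>\<^sub>o\<^bsub>T\<^esub> B)"
    and \<phi>_pure: "\<And>l a b. \<lbrakk>l \<in> carrier (RR R T); a \<in> carrier A; b \<in> carrier B\<rbrakk> \<Longrightarrow>
      \<phi> (pure_triple A B l a b) = fn (pt A a \<and>\<^sub>a\<^bsub>T\<^esub> pt B b) l"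
  shows "\<phi> \<in> lmod_iso R (triple A B) (A \<and>\<^sub>o\<^bsub>T\<^esub> B)"
proof -
  interpret P: tensor3_factors R "RR R T" "RR_act1 R T" "RR_act2 R T" A B by (rule factors[OF A B])
  note AB = tensor_obj[OF A B]
  have m: "left_module R (A \<and>\<^sub>o\<^bsub>T\<^esub> B)" using AB by (simp add: Obj_LMod)
  have small: "carrier (triple A B) \<prec> (UNIV :: 'u set)"
    using RR_Obj by (intro small_tensor3[OF U twofold_RR _ A B]) (simp add: Obj_LMod)
  then obtain \<tau> :: "_ \<Rightarrow> 'u" where inj: "inj_on \<tau> (carrier (triple A B))"
    by (auto simp: lesspoll_def lepoll_def)
  define N where "N = transport_module \<tau> (triple A B)"
  have N: "left_module R N" and \<tau>: "\<tau> \<in> lmod_iso R (triple A B) N"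
    unfolding N_def by (rule transport_module[OF P.Q.left_module_axioms inj])+
  have \<tau>h: "\<tau> \<in> lmod_hom R (triple A B) N" using \<tau> by (simp add: lmod_iso_def)
  have "carrier N = \<tau> ` carrier (triple A B)" using \<tau> by (auto simp: lmod_iso_def bij_betw_def)
  then have NO: "N \<in> Obj (LMod R)" using N small_image[OF small] by (simp add: Obj_LMod)
  note \<tau>_add = lmod_hom_add[OF \<tau>h, symmetric]
  have "\<exists>k\<in>Hom (LMod R) (A \<and>\<^sub>o\<^bsub>T\<^esub> B) N. \<forall>l\<in>carrier (RR R T). \<forall>a\<in>carrier A. \<forall>b\<in>carrier B.
      fn k (fn (pt A a \<and>\<^sub>a\<^bsub>T\<^esub> pt B b) l) = \<tau> (pure_triple A B l a b)"
  proof (rule tensor_universal[OF A B NO])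
    fix a b assume "a \<in> carrier A" "b \<in> carrier B"
    then have "(\<lambda>l. pure_triple A B l a b) \<in> lmod_hom R (RR R T) (triple A B)"
      by (auto simp: lmod_hom_def P.pure_add_left P.smult_pure)
    then show "(\<lambda>l. \<tau> (pure_triple A B l a b)) \<in> lmod_hom R (RR R T) N" using \<tau>h by (rule lmod_hom_comp)
  qed (simp_all add: P.pure_add_middle P.pure_add_right P.pure_act1 P.pure_act2 \<tau>_add)
  then obtain k where k: "k \<in> Hom (LMod R) (A \<and>\<^sub>o\<^bsub>T\<^esub> B) N"
    and k_pure: "\<And>l a b. \<lbrakk>l \<in> carrier (RR R T); a \<in> carrier A; b \<in> carrier B\<rbrakk> \<Longrightarrow>
      fn k (fn (pt A a \<and>\<^sub>a\<^bsub>T\<^esub> pt B b) l) = \<tau> (pure_triple A B l a b)" by blast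
  \<comment> \<open>Both sides are linear and agree on pure tensors; so \<open>k\<close> is a left
    inverse of \<phi> up to the bijection \<tau>.\<close>
  have k\<phi>: "fn k (\<phi> t) = \<tau> t" if "t \<in> carrier (triple A B)" for t
    by (rule P.lmod_hom_eqI[OF N lmod_hom_comp[OF \<phi> fn_hom[OF k]] \<tau>h _ that])
      (simp add: \<phi>_pure k_pure)
  have "inj_on \<phi> (carrier (triple A B))"
  proof (rule inj_onI)
    fix s t assume st: "s \<in> carrier (triple A B)" "t \<in> carrier (triple A B)" "\<phi> s = \<phi> t"
    have "\<tau> s = \<tau> t" using k\<phi>[OF st(1)] k\<phi>[OF st(2)] st(3) by simp
    then show "s = t" using st(1,2) by (rule inj_onD[OF inj])
  qed
  moreover have "y \<in> \<phi> ` carrier (triple A B)" if y: "y \<in> carrier (A \<and>\<^sub>o\<^bsub>T\<^esub> B)" for y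
  proof -
    \<comment> \<open>Here \<sigma> undoes \<tau>. The composite of \<open>k\<close>, \<sigma> and
      \<phi> is packed as an arrow \<open>?e\<close>, so that uniqueness can compare it with the
      identity; every \<open>y\<close> is then a value of \<phi>.\<close>
    let ?\<sigma> = "inv_into (carrier (triple A B)) \<tau>"
    have \<sigma>: "?\<sigma> \<in> lmod_hom R N (triple A B)" by (rule inv_lmod_iso[OF P.Q.left_module_axioms \<tau>])
    have \<sigma>k: "(\<lambda>x. ?\<sigma> (fn k x)) \<in> lmod_hom R (A \<and>\<^sub>o\<^bsub>T\<^esub> B) (triple A B)"
      by (rule lmod_hom_comp[OF fn_hom[OF k] \<sigma>])
    let ?e = "Arr (A \<and>\<^sub>o\<^bsub>T\<^esub> B) (\<lambda>x\<in>carrier (A \<and>\<^sub>o\<^bsub>T\<^esub> B). \<phi> (?\<sigma> (fn k x))) (A \<and>\<^sub>o\<^bsub>T\<^esub> B)"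
    have "?e = Id (LMod R) (A \<and>\<^sub>o\<^bsub>T\<^esub> B)"
    proof (rule tensor_ext[OF A B AB lmod_hom_arr[OF m lmod_hom_comp[OF \<sigma>k \<phi>]] Id_in_Hom[OF AB]])
      fix l a b assume *: "l \<in> carrier (RR R T)" "a \<in> carrier A" "b \<in> carrier B"
      have "fn (pt A a \<and>\<^sub>a\<^bsub>T\<^esub> pt B b) l \<in> carrier (A \<and>\<^sub>o\<^bsub>T\<^esub> B)"
        using lmod_hom_closed[OF \<phi> P.pure_closed[OF *]] * by (simp add: \<phi>_pure)
      then show "fn ?e (fn (pt A a \<and>\<^sub>a\<^bsub>T\<^esub> pt B b) l)
          = fn (Id (LMod R) (A \<and>\<^sub>o\<^bsub>T\<^esub> B)) (fn (pt A a \<and>\<^sub>a\<^bsub>T\<^esub> pt B b) l)"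
        using * inj by (simp add: fn_Id k_pure \<phi>_pure)
    qed
    then have "fn ?e y = fn (Id (LMod R) (A \<and>\<^sub>o\<^bsub>T\<^esub> B)) y" by (rule arg_cong)
    then have "y = \<phi> (?\<sigma> (fn k y))" using y by (simp add: fn_Id)
    then show ?thesis using lmod_hom_closed[OF \<sigma>k y] by (rule image_eqI)
  qed
  ultimately show ?thesis
    using \<phi> by (auto simp: lmod_iso_def bij_betw_def lmod_hom_closed)
qed

end

theorem theorem2p1:
  fixes R :: "('u, 'z) ring_scheme"
    and T :: "(('u, 'u) module, ('u, 'u) lmod_arr) monoidal_data"
  assumes "ring R"
    and "universe TYPE('u)"
    and "small (carrier R)"
    and "closed_symmetric_monoidal (LMod R) T"
    and "additive_tensor R T"
  shows "twofold_bimodule R (RR R T) (RR_act1 R T) (RR_act2 R T) \<and>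
    (\<exists>\<phi>. (\<forall>A\<in>Obj (LMod R). \<forall>B\<in>Obj (LMod R).
            \<phi> A B \<in> lmod_iso R (tensor3 R (RR R T) (RR_act1 R T) (RR_act2 R T) A B)
                               (A \<and>\<^sub>o\<^bsub>T\<^esub> B)) \<and>
         (\<forall>A\<in>Obj (LMod R). \<forall>A'\<in>Obj (LMod R). \<forall>B\<in>Obj (LMod R). \<forall>B'\<in>Obj (LMod R).
            \<forall>f\<in>Hom (LMod R) A A'. \<forall>g\<in>Hom (LMod R) B B'.
            \<forall>x\<in>carrier (tensor3 R (RR R T) (RR_act1 R T) (RR_act2 R T) A B).
              \<phi> A' B' (tensor3_map R (RR R T) (RR_act1 R T) (RR_act2 R T) f g x)
                = fn (f \<and>\<^sub>a\<^bsub>T\<^esub> g) (\<phi> A B x)))"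
proof -
  interpret additive_closed_monoidal R T
    using assms by (intro additive_closed_monoidal.intro additive_closed_monoidal_axioms.intro)
  have "\<forall>A\<in>Obj (LMod R). \<forall>B\<in>Obj (LMod R). \<exists>\<phi>\<in>lmod_hom R (triple A B) (A \<and>\<^sub>o\<^bsub>T\<^esub> B).
      \<forall>l\<in>carrier (RR R T). \<forall>a\<in>carrier A. \<forall>b\<in>carrier B.
        \<phi> (pure_triple A B l a b) = fn (pt A a \<and>\<^sub>a\<^bsub>T\<^esub> pt B b) l"
    using comparison_exists by blast
  \<comment> \<open>The choice is harmless, as a linear map is determined by its values on pure
    tensors.\<close>
  then obtain \<phi> where \<phi>: "\<And>A B. \<lbrakk>A \<in> Obj (LMod R); B \<in> Obj (LMod R)\<rbrakk> \<Longrightarrow>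
      \<phi> A B \<in> lmod_hom R (triple A B) (A \<and>\<^sub>o\<^bsub>T\<^esub> B)"
    and \<phi>_pure: "\<And>A B l a b. \<lbrakk>A \<in> Obj (LMod R); B \<in> Obj (LMod R); l \<in> carrier (RR R T);
      a \<in> carrier A; b \<in> carrier B\<rbrakk> \<Longrightarrow>
      \<phi> A B (pure_triple A B l a b) = fn (pt A a \<and>\<^sub>a\<^bsub>T\<^esub> pt B b) l"
    by metis
  \<comment> \<open>Both sides are linear in \<open>x\<close>, so pure tensors suffice. There the
    claim is that rho_a followed by \<open>f\<close> is rho_(f a), and likewise for
    \<open>g\<close>.\<close>
  have natural: "\<phi> A' B' (tensor3_map R (RR R T) (RR_act1 R T) (RR_act2 R T) f g x)
      = fn (f \<and>\<^sub>a\<^bsub>T\<^esub> g) (\<phi> A B x)"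
    if A: "A \<in> Obj (LMod R)" "A' \<in> Obj (LMod R)" and B: "B \<in> Obj (LMod R)" "B' \<in> Obj (LMod R)"
      and f: "f \<in> Hom (LMod R) A A'" and g: "g \<in> Hom (LMod R) B B'" and x: "x \<in> carrier (triple A B)"
    for A A' B B' f g x
  proof -
    interpret P: tensor3_factors R "RR R T" "RR_act1 R T" "RR_act2 R T" A B by (rule factors[OF A(1) B(1)])
    have ml: "left_module R A" "left_module R A'" "left_module R B" "left_module R B'"
      "left_module R (A' \<and>\<^sub>o\<^bsub>T\<^esub> B')"
      using A B tensor_obj[OF A(2) B(2)] by (auto simp: Obj_LMod)
    note fg = tensor_arr[OF A B f g]
    show ?thesis
    proof (rule P.lmod_hom_eqI[OF ml(5) _ _ _ x])
      show "(\<lambda>x. \<phi> A' B' (tensor3_map R (RR R T) (RR_act1 R T) (RR_act2 R T) f g x))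
          \<in> lmod_hom R (triple A B) (A' \<and>\<^sub>o\<^bsub>T\<^esub> B')"
        by (rule lmod_hom_comp[OF tensor3_map_hom[OF twofold_RR ml(1-4) f g] \<phi>[OF A(2) B(2)]])
      show "(\<lambda>x. fn (f \<and>\<^sub>a\<^bsub>T\<^esub> g) (\<phi> A B x)) \<in> lmod_hom R (triple A B) (A' \<and>\<^sub>o\<^bsub>T\<^esub> B')"
        by (rule lmod_hom_comp[OF \<phi>[OF A(1) B(1)] fn_hom[OF fg]])
      fix l a b assume *: "l \<in> carrier (RR R T)" "a \<in> carrier A" "b \<in> carrier B"
      have l: "l \<in> carrier (RM \<and>\<^sub>o\<^bsub>T\<^esub> RM)" using *(1) by (simp add: RR_def)
      have "fn (f \<and>\<^sub>a\<^bsub>T\<^esub> g) (fn (pt A a \<and>\<^sub>a\<^bsub>T\<^esub> pt B b) l)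
          = fn (pt A' (fn f a) \<and>\<^sub>a\<^bsub>T\<^esub> pt B' (fn g b)) l"
        using fn_tensor_Comp[OF RM_Obj A RM_Obj B pt_Hom[OF A(1) *(2)] f pt_Hom[OF B(1) *(3)] g l]
        by (simp add: comp_point[OF ml(1,2) *(2) f] comp_point[OF ml(3,4) *(3) g])
      then show "\<phi> A' B' (tensor3_map R (RR R T) (RR_act1 R T) (RR_act2 R T) f g (pure_triple A B l a b))
          = fn (f \<and>\<^sub>a\<^bsub>T\<^esub> g) (\<phi> A B (pure_triple A B l a b))"
        using * by (simp add: tensor3_map_pure[OF factors[OF A(1) B(1)] factors[OF A(2) B(2)] f g]
            \<phi>_pure A B fn_closed[OF f] fn_closed[OF g])
    qed
  qed
  show ?thesis
    proof (intro conjI exI[of _ \<phi>] ballI)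
    show "\<phi> A B \<in> lmod_iso R (triple A B) (A \<and>\<^sub>o\<^bsub>T\<^esub> B)"
      if "A \<in> Obj (LMod R)" "B \<in> Obj (LMod R)" for A B
      by (rule comparison_iso[OF assms(2) that \<phi>[OF that] \<phi>_pure[OF that]])
  qed (rule twofold_RR, rule natural)
qed

end
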